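(* Let $k\in\{1,\dots,m\}$. There exists $p\in\mathbb N\cup\{0\}$ (not depending on $n$) such that the $k$th polynomials $P_{n;i_1,\dots,i_k}$ of the Hermite--Padé $m$-system of order $n$ constructed from $[1,f_{1,\infty},\dots,f_{m,\infty}]$ at $\infty$ satisfy $$\sum_{0\le i_1<\dots<i_k\le m}P_{n;i_1,\dots,i_k}(z)\,A_{i_1,\dots,i_k}(\widetilde{\mathbf z}^{(l_1\dots l_k)})=O\left(\frac1{z^{nk+1-p}}\right)\quad\text{as } z\to\infty$$ for all $0\le l_1<l_2<\dots<l_k\le m$ with $l_1\ne0$.
   Context: Setting. $\mathfrak R$ is a compact connected Riemann surface, $\pi:\mathfrak R\to\widehat{\mathbb C}$ an $(m+1)$-sheeted holomorphic branched covering of the Riemann sphere, $m\ge1$, and $\Sigma$ the set of critical values of $\pi$. Points of $\mathfrak R$ are written in boldface, $\pi(\mathbf z)=z$. $f_1,\dots,f_m$ are meromorphic functions on $\mathfrak R$ such that $1,f_1,\dots,f_m$ are linearly independent over $\mathbb C(z)$. $\pmb\infty^{(0)}\in\pi^{-1}(\infty)$ is a fixed point that is not a critical point of $\pi$ (the case $\infty\in\Sigma$ is allowed). $f_{j,\infty}(z):=f_j(\pi_0^{-1}(z))$, where $\pi_0^{-1}$ is the local inverse of $\pi$ near $\pmb\infty^{(0)}$; the germs $f_{j,\infty}$ are assumed holomorphic at $\infty$. $k$th polynomials of the Hermite--Padé $m$-system of order $n$: any polynomials $P_{n;i_1,\dots,i_k}$, $0\le i_1<\dots<i_k\le m$, with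 $\deg P_{n;i_1,\dots,i_k}\le(m+1-k)n$, at least one of them $\not\equiv0$, such that for every $0<j_1<\dots<j_k\le m$, $$P_{n;j_1,\dots,j_k}(z)+\sum_{s=1}^k(-1)^sP_{n;0,j_1,\dots,j_{s-1},j_{s+1},\dots,j_k}(z)f_{j_s,\infty}(z)=O(z^{-(kn+1)}),\quad z\to\infty.$$ Nuttall partition. $u$ is a harmonic function on $\mathfrak R\setminus\pi^{-1}(\infty)$ with $u(\mathbf z)=-m\log|z|+O(1)$ as $\mathbf z\to\pmb\infty^{(0)}$ and $u(\mathbf z)=\log|z|+O(1)$ as $\mathbf z\to\pi^{-1}(\infty)\setminus\{\pmb\infty^{(0)}\}$; it exists and is unique up to an additive constant. For $z\in\mathbb C$, $u_0(z)\le\dots\le u_m(z)$ are the values of $u$ at the points of $\pi^{-1}(z)$ (counted with multiplicity) in nondecreasing order; for $z=\infty$ one orders instead the values of $u-\log|z|$ (the value at $\pmb\infty^{(0)}$ being $-\infty$). $F_j:=\{z\in\widehat{\mathbb C}:u_{j-1}(z)=u_j(z)\}$, $F:=\bigcup_{j=1}^mF_j$ (one-dimensional piecewise analytic sets). For $z\in\widehat{\mathbb C}\setminus F$, $\mathbf z^{(j)}$ denotes the point of $\pi^{-1}(z)$ with $u(\mathbf z^{(j)})=u_j(z)$, $j=0,\dots,m$ (for $z=\infty\notin F$, $\mathbf z^{(j)}$ is instead the point of $\pi^{-1}(\infty)$ at which $u-\log|z|$ takes the $j$th value, counting from $j=0$, in the nondecreasing ordering of its values at the points of $\pi^{-1}(\infty)$,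 the value at $\pmb\infty^{(0)}$ being $-\infty$). The surface $\widetilde{\mathfrak R}_{[k]}$ and its sheets. Regard $\pi^{-1}(\cdot)$ as an $(m+1)$-valued global analytic function on $\widehat{\mathbb C}\setminus\Sigma$. $\widetilde{\mathfrak R}_{[k]}$ is the standard compactification of the Riemann surface of pairs $(z,\{w_1^z,\dots,w_k^z\})$, where $z\in\widehat{\mathbb C}\setminus\Sigma$ and $\{w^z_1,\dots,w^z_k\}$ is an unordered collection of $k$ distinct germs of this function at $z$ (complex structure by analytic continuation of germs). It is a compact, possibly disconnected, Riemann surface with a $\binom{m+1}k$-sheeted branched covering $\widetilde\pi:\widetilde{\mathfrak R}_{[k]}\to\widehat{\mathbb C}$. For $z\in\widehat{\mathbb C}\setminus F$ and $0\le l_1<\dots<l_k\le m$, $\widetilde{\mathbf z}^{(l_1\dots l_k)}$ denotes the point of $\widetilde{\mathfrak R}_{[k]}$ over $z$ given by the germs corresponding to $\mathbf z^{(l_1)},\dots,\mathbf z^{(l_k)}$. Asymptotics as $z\to\infty$ are taken over $z\in\widehat{\mathbb C}\setminus F$. The functions $A_{j_1,\dots,j_k}$. For $z\in\widehat{\mathbb C}\setminus F$ let $A(z)$ be the matrix with rows $(1,f_1(\mathbf z^{(l)}),\dots,f_m(\mathbf z^{(l)}))$, $l=0,\dots,m$ (rows and columns numbered from $0$); $\det A\not\equiv0$. $A^{l_1,\dots,l_k}_{j_1,\dots,j_k}(z)$ is the algebraic complement of the minor with columns $j_1,\dots,j_k$ and rows $l_1,\dots,l_k$, i.e. the complementary minor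 times $(-1)^{j_1+\dots+j_k+l_1+\dots+l_k}$. Let $w$ be a fixed meromorphic function on $\mathfrak R$ realizing $\mathfrak R$ as the Riemann surface of an $(m+1)$-valued algebraic function of $z$ (i.e. $w$ generates the field of meromorphic functions of $\mathfrak R$ over $\mathbb C(z)$), and put $M_w^{l_1,\dots,l_k}(z):=\prod_{1\le i<j\le k}(w(\mathbf z^{(l_j)})-w(\mathbf z^{(l_i)}))$ (which is $\not\equiv0$; it is $1$ for $k=1$). Then $$A_{j_1,\dots,j_k}(\widetilde{\mathbf z}^{(l_1\dots l_k)}):=\frac{A^{l_1,\dots,l_k}_{j_1,\dots,j_k}(z)\,M_w^{l_1,\dots,l_k}(z)}{\det A(z)}.$$ *)

theory Defs
  imports
    "HOL-Complex_Analysis.Complex_Analysis"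
    "HOL-Library.Landau_Symbols"
    "Jordan_Normal_Form.Determinant"
    "Jordan_Normal_Form.DL_Submatrix"
begin

section \<open>Riemann surfaces and holomorphic maps\<close>

type_synonym 'a chart = "'a set \<times> ('a \<Rightarrow> complex)"

definition is_chart :: "'a topology \<Rightarrow> 'a chart \<Rightarrow> bool" where
  "is_chart X c \<longleftrightarrow> (case c of (U, \<phi>) \<Rightarrow>
     openin X U \<and> open (\<phi> ` U) \<and>
     homeomorphic_map (subtopology X U) (top_of_set (\<phi> ` U)) \<phi>)"

text \<open>Neither connectedness nor second countability is part of this definition; for the compact
  surfaces considered here the latter is automatic. The atlas need not be maximal.\<close>

definition riemann_surface :: "'a topology \<Rightarrow> 'a chart set \<Rightarrow> bool" where
  "riemann_surface X \<A> \<longleftrightarrow>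
     Hausdorff_space X \<and>
     (\<forall>c\<in>\<A>. is_chart X c) \<and>
     (\<Union>c\<in>\<A>. fst c) = topspace X \<and>
     (\<forall>(U, \<phi>)\<in>\<A>. \<forall>(V, \<psi>)\<in>\<A>. (\<psi> \<circ> inv_into U \<phi>) holomorphic_on \<phi> ` (U \<inter> V))"

definition holomorphic_map ::
    "'a topology \<Rightarrow> 'a chart set \<Rightarrow> 'b topology \<Rightarrow> 'b chart set \<Rightarrow> ('a \<Rightarrow> 'b) \<Rightarrow> bool" where
  "holomorphic_map X \<A> Y \<B> f \<longleftrightarrow>
     continuous_map X Y f \<and>
     (\<forall>(U, \<phi>)\<in>\<A>. \<forall>(V, \<psi>)\<in>\<B>. (\<psi> \<circ> f \<circ> inv_into U \<phi>) holomorphic_on \<phi> ` (U \<inter> f -` V))"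

text \<open>For a nonconstant holomorphic map the multiplicity at a point does not depend on the
  charts chosen.\<close>

definition chart_at :: "'a chart set \<Rightarrow> 'a \<Rightarrow> 'a chart" where
  "chart_at \<A> x = (SOME c. c \<in> \<A> \<and> x \<in> fst c)"

definition multiplicity_at :: "'a chart set \<Rightarrow> 'b chart set \<Rightarrow> ('a \<Rightarrow> 'b) \<Rightarrow> 'a \<Rightarrow> nat" where
  "multiplicity_at \<A> \<B> f x =
     (let (U, \<phi>) = chart_at \<A> x; (V, \<psi>) = chart_at \<B> (f x)
      in nat (zorder (\<lambda>\<zeta>. \<psi> (f (inv_into U \<phi> \<zeta>)) - \<psi> (f x)) (\<phi> x)))"

section \<open>The Riemann sphere and meromorphic functions\<close>

text \<open>The point at infinity is \<^term>\<open>None\<close>.\<close>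

definition riemann_sphere :: "complex option topology" where
  "riemann_sphere = Alexandroff_compactification euclidean"

definition riemann_sphere_atlas :: "complex option chart set" where
  "riemann_sphere_atlas =
     {(range Some, the), (UNIV - {Some 0}, \<lambda>x. case x of None \<Rightarrow> 0 | Some z \<Rightarrow> inverse z)}"

definition meromorphic_function ::
    "'a topology \<Rightarrow> 'a chart set \<Rightarrow> ('a \<Rightarrow> complex option) \<Rightarrow> bool" where
  "meromorphic_function X \<A> f \<longleftrightarrow>
     holomorphic_map X \<A> riemann_sphere riemann_sphere_atlas f \<and> (\<exists>x\<in>topspace X. f x \<noteq> None)"

definition fiber :: "'a topology \<Rightarrow> ('a \<Rightarrow> complex option) \<Rightarrow> complex option \<Rightarrow> 'a set" where
  "fiber X \<pi> z = {x \<in> topspace X. \<pi> x = z}"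

definition critical_points ::
    "'a topology \<Rightarrow> 'a chart set \<Rightarrow> ('a \<Rightarrow> complex option) \<Rightarrow> 'a set" where
  "critical_points X \<A> \<pi> = {x \<in> topspace X. multiplicity_at \<A> riemann_sphere_atlas \<pi> x > 1}"

definition critical_values ::
    "'a topology \<Rightarrow> 'a chart set \<Rightarrow> ('a \<Rightarrow> complex option) \<Rightarrow> complex option set" where
  "critical_values X \<A> \<pi> = \<pi> ` critical_points X \<A> \<pi>"

text \<open>On a compact connected surface every nonconstant holomorphic map to the sphere is a branched
  covering, so only the number of sheets has to be prescribed. A constant map is excluded by the
  fibre condition with \<^term>\<open>d > 0\<close>.\<close>

definition branched_covering ::
    "'a topology \<Rightarrow> 'a chart set \<Rightarrow> nat \<Rightarrow> ('a \<Rightarrow> complex option) \<Rightarrow> bool" where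
  "branched_covering X \<A> d \<pi> \<longleftrightarrow>
     holomorphic_map X \<A> riemann_sphere riemann_sphere_atlas \<pi> \<and>
     (\<forall>z. z \<notin> critical_values X \<A> \<pi> \<longrightarrow> card (fiber X \<pi> z) = d)"

text \<open>\<open>col f\<close> prepends the constant function 1 to the family \<open>f 1, f 2, \<dots>\<close>. Its value at a pole is
  arbitrary. Below, identities between meromorphic functions are therefore required only off
  a finite set, which on a compact connected surface amounts to equality.\<close>

definition col :: "(nat \<Rightarrow> 'a \<Rightarrow> complex option) \<Rightarrow> nat \<Rightarrow> 'a \<Rightarrow> complex" where
  "col f j x = (if j = 0 then 1 else the (f j x))"

text \<open>Linear independence of \<open>1, f 1, \<dots>, f m\<close> over the field of rational functions of \<open>z\<close>; the
  coefficients are the fractions \<open>a j / b j\<close>.\<close>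

definition lin_indep_over_rational ::
    "'a topology \<Rightarrow> ('a \<Rightarrow> complex option) \<Rightarrow> nat \<Rightarrow> (nat \<Rightarrow> 'a \<Rightarrow> complex option) \<Rightarrow> bool" where
  "lin_indep_over_rational X \<pi> m f \<longleftrightarrow>
     (\<forall>a b :: nat \<Rightarrow> complex poly.
        (\<forall>j\<le>m. b j \<noteq> 0) \<and>
        finite {x \<in> topspace X.
          (\<Sum>j\<le>m. poly (a j) (the (\<pi> x)) / poly (b j) (the (\<pi> x)) * col f j x) \<noteq> 0}
        \<longrightarrow> (\<forall>j\<le>m. a j = 0))"

text \<open>\<open>w\<close> generates the field of meromorphic functions over the rational functions of \<open>z\<close>: every
  meromorphic function is a quotient \<open>N(z, w) / D(z, w)\<close> of two polynomials.\<close>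

definition poly2 :: "complex poly poly \<Rightarrow> complex \<Rightarrow> complex \<Rightarrow> complex" where
  "poly2 N z t = poly (map_poly (\<lambda>c. poly c z) N) t"

definition generates_function_field ::
    "'a topology \<Rightarrow> 'a chart set \<Rightarrow> ('a \<Rightarrow> complex option) \<Rightarrow> ('a \<Rightarrow> complex option) \<Rightarrow> bool" where
  "generates_function_field X \<A> \<pi> w \<longleftrightarrow>
     (\<forall>g. meromorphic_function X \<A> g \<longrightarrow>
        (\<exists>N D. finite {x \<in> topspace X.
           \<not> (poly2 D (the (\<pi> x)) (the (w x)) \<noteq> 0 \<and>
              the (g x) = poly2 N (the (\<pi> x)) (the (w x)) / poly2 D (the (\<pi> x)) (the (w x)))}))"

section \<open>Germs at infinity and Hermite--Pade polynomials\<close>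

definition local_inverse_at_infinity ::
    "'a topology \<Rightarrow> ('a \<Rightarrow> complex option) \<Rightarrow> 'a \<Rightarrow> (complex option \<Rightarrow> 'a) \<Rightarrow> bool" where
  "local_inverse_at_infinity X \<pi> p s \<longleftrightarrow>
     (\<exists>V. openin riemann_sphere V \<and> None \<in> V \<and> continuous_map (subtopology riemann_sphere V) X s \<and>
        s None = p \<and> (\<forall>z\<in>V. \<pi> (s z) = z))"

definition germ_at_infinity ::
    "('a \<Rightarrow> complex option) \<Rightarrow> (complex option \<Rightarrow> 'a) \<Rightarrow> complex \<Rightarrow> complex" where
  "germ_at_infinity f s z = the (f (s (Some z)))"

definition holomorphic_at_infinity :: "(complex \<Rightarrow> complex) \<Rightarrow> bool" where
  "holomorphic_at_infinity g \<longleftrightarrow>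
     (\<exists>h. h analytic_on {0} \<and> (\<forall>\<^sub>F z in at_infinity. g z = h (inverse z)))"

text \<open>A multi-index \<open>i\<^sub>1 < \<dots> < i\<^sub>k\<close> is encoded as the set of its entries.\<close>

definition multi_indices :: "nat \<Rightarrow> nat \<Rightarrow> nat set set" where
  "multi_indices m k = {I. I \<subseteq> {0..m} \<and> card I = k}"

definition hermite_pade ::
    "nat \<Rightarrow> nat \<Rightarrow> nat \<Rightarrow> (nat \<Rightarrow> complex \<Rightarrow> complex) \<Rightarrow> (nat set \<Rightarrow> complex poly) \<Rightarrow> bool" where
  "hermite_pade m k n g P \<longleftrightarrow>
     (\<forall>I\<in>multi_indices m k. degree (P I) \<le> (m + 1 - k) * n) \<and>
     (\<exists>I\<in>multi_indices m k. P I \<noteq> 0) \<and>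
     (\<forall>J\<in>multi_indices m k. 0 \<notin> J \<longrightarrow>
        (let j = (\<lambda>s. sorted_list_of_set J ! (s - 1)) in
         (\<lambda>z. poly (P J) z +
              (\<Sum>s=1..k. (-1) ^ s * poly (P (insert 0 (J - {j s}))) z * g (j s) z))
         \<in> O[at_infinity](\<lambda>z. 1 / z ^ (k * n + 1))))"

section \<open>The Nuttall partition\<close>

definition harmonic_on :: "(complex \<Rightarrow> real) \<Rightarrow> complex set \<Rightarrow> bool" where
  "harmonic_on u S \<longleftrightarrow> open S \<and>
     (\<exists>ux uy uxx uxy uyx uyy.
        (\<forall>z\<in>S. (u has_derivative (\<lambda>h. ux z * Re h + uy z * Im h)) (at z) \<and>
               (ux has_derivative (\<lambda>h. uxx z * Re h + uxy z * Im h)) (at z) \<and>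
               (uy has_derivative (\<lambda>h. uyx z * Re h + uyy z * Im h)) (at z) \<and>
               uxx z + uyy z = 0) \<and>
        continuous_on S uxx \<and> continuous_on S uxy \<and> continuous_on S uyx \<and> continuous_on S uyy)"

definition harmonic_on_surface :: "'a chart set \<Rightarrow> 'a set \<Rightarrow> ('a \<Rightarrow> real) \<Rightarrow> bool" where
  "harmonic_on_surface \<A> D u \<longleftrightarrow>
     (\<forall>(U, \<phi>)\<in>\<A>. harmonic_on (u \<circ> inv_into U \<phi>) (\<phi> ` (U \<inter> D)))"

definition nuttall_function ::
    "'a topology \<Rightarrow> 'a chart set \<Rightarrow> nat \<Rightarrow> ('a \<Rightarrow> complex option) \<Rightarrow> 'a \<Rightarrow> ('a \<Rightarrow> real) \<Rightarrow> bool" where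
  "nuttall_function X \<A> m \<pi> p u \<longleftrightarrow>
     harmonic_on_surface \<A> (topspace X - fiber X \<pi> None) u \<and>
     (\<lambda>x. u x + real m * ln (cmod (the (\<pi> x)))) \<in> O[atin X p](\<lambda>_. 1) \<and>
     (\<forall>q \<in> fiber X \<pi> None - {p}.
        (\<lambda>x. u x - ln (cmod (the (\<pi> x)))) \<in> O[atin X q](\<lambda>_. 1))"

text \<open>The quantity by which the points of a fibre are ordered: \<open>u\<close> over finite points, and the
  boundary value of \<open>u - log |z|\<close>, which is \<open>-\<infinity>\<close> at the distinguished point, over infinity.\<close>

definition height :: "'a topology \<Rightarrow> ('a \<Rightarrow> complex option) \<Rightarrow> ('a \<Rightarrow> real) \<Rightarrow> 'a \<Rightarrow> ereal" where
  "height X \<pi> u x =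
     (if \<pi> x = None then Lim (atin X x) (\<lambda>y. ereal (u y - ln (cmod (the (\<pi> y)))))
      else ereal (u x))"

definition ordered_value ::
    "'a topology \<Rightarrow> 'a chart set \<Rightarrow> ('a \<Rightarrow> complex option) \<Rightarrow> ('a \<Rightarrow> real) \<Rightarrow> nat \<Rightarrow>
     complex option \<Rightarrow> ereal" where
  "ordered_value X \<A> \<pi> u j z =
     sorted_list_of_multiset
       (\<Sum>x\<in>fiber X \<pi> z. replicate_mset (multiplicity_at \<A> riemann_sphere_atlas \<pi> x) (height X \<pi> u x)) ! j"

definition nuttall_set ::
    "'a topology \<Rightarrow> 'a chart set \<Rightarrow> nat \<Rightarrow> ('a \<Rightarrow> complex option) \<Rightarrow> ('a \<Rightarrow> real) \<Rightarrow>
     complex option set" where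
  "nuttall_set X \<A> m \<pi> u =
     (\<Union>j\<in>{1..m}. {z. ordered_value X \<A> \<pi> u (j - 1) z = ordered_value X \<A> \<pi> u j z})"

text \<open>Meaningful for \<open>z\<close> outside \<^const>\<open>nuttall_set\<close>.\<close>

definition sheet ::
    "'a topology \<Rightarrow> 'a chart set \<Rightarrow> ('a \<Rightarrow> complex option) \<Rightarrow> ('a \<Rightarrow> real) \<Rightarrow>
     complex option \<Rightarrow> nat \<Rightarrow> 'a" where
  "sheet X \<A> \<pi> u z j = (THE x. x \<in> fiber X \<pi> z \<and> height X \<pi> u x = ordered_value X \<A> \<pi> u j z)"

section \<open>The functions on the surface of unordered collections of germs\<close>

text \<open>Over a point \<open>z\<close> that is not a critical value, a germ of \<open>\<pi>\<^sup>-\<^sup>1\<close> is determined by its value,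
  a point of the fibre. So a point over \<open>z\<close> of the surface of unordered collections of \<open>k\<close> germs is
  represented by \<open>z\<close> together with a \<open>k\<close>-element subset of the fibre. All critical values lie in
  \<^const>\<open>nuttall_set\<close>.\<close>

definition collection_point ::
    "'a topology \<Rightarrow> 'a chart set \<Rightarrow> ('a \<Rightarrow> complex option) \<Rightarrow> ('a \<Rightarrow> real) \<Rightarrow>
     complex option \<Rightarrow> nat set \<Rightarrow> complex option \<times> 'a set" where
  "collection_point X \<A> \<pi> u z L = (z, sheet X \<A> \<pi> u z ` L)"

definition system_matrix ::
    "nat \<Rightarrow> (nat \<Rightarrow> 'a \<Rightarrow> complex option) \<Rightarrow> (nat \<Rightarrow> 'a) \<Rightarrow> complex Matrix.mat" where
  "system_matrix m f zs = Matrix.mat (m + 1) (m + 1) (\<lambda>(l, j). col f j (zs l))"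

text \<open>The algebraic complement of the minor with rows \<open>L\<close> and columns \<open>J\<close>.\<close>

definition algebraic_complement ::
    "complex Matrix.mat \<Rightarrow> nat set \<Rightarrow> nat set \<Rightarrow> complex" where
  "algebraic_complement M L J =
     (-1) ^ (\<Sum>J + \<Sum>L) *
     Determinant.det (submatrix M ({0..<dim_row M} - L) ({0..<dim_col M} - J))"

definition vandermonde_product :: "('a \<Rightarrow> complex option) \<Rightarrow> (nat \<Rightarrow> 'a) \<Rightarrow> nat set \<Rightarrow> complex" where
  "vandermonde_product w zs L =
     (\<Prod>(i, j)\<in>{(i, j). i \<in> L \<and> j \<in> L \<and> i < j}. the (w (zs j)) - the (w (zs i)))"

definition A_function ::
    "'a topology \<Rightarrow> 'a chart set \<Rightarrow> nat \<Rightarrow> ('a \<Rightarrow> complex option) \<Rightarrow> ('a \<Rightarrow> real) \<Rightarrow>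
     (nat \<Rightarrow> 'a \<Rightarrow> complex option) \<Rightarrow> ('a \<Rightarrow> complex option) \<Rightarrow>
     nat set \<Rightarrow> complex option \<times> 'a set \<Rightarrow> complex" where
  "A_function X \<A> m \<pi> u f w J zS =
     (let z = fst zS;
          zs = sheet X \<A> \<pi> u z;
          L = {l \<in> {0..m}. zs l \<in> snd zS};
          M = system_matrix m f zs
      in algebraic_complement M L J * vandermonde_product w zs L / Determinant.det M)"

end

theory Submission
  imports Defs
begin

text \<open>Put \<open>T K = (\<Sum>j\<in>K. \<plusminus> P (K - {j}) * f j)\<close> for a set \<open>K\<close> of \<open>k + 1\<close> columns, where \<open>f 0 = 1\<close> and the
  \<open>f j\<close> are the germs at infinity. If \<open>0 \<in> K\<close>, then \<open>T K\<close> is one of the expressions in the definition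
  of the Hermite--Pade polynomials, and as the Koszul differential squares to zero, the other \<open>T K\<close>
  are combinations of these with bounded coefficients. The harmonic function \<open>u\<close> is smallest at the
  point of the distinguished branch, so row \<open>0\<close> of the system matrix consists of the \<open>f j\<close>. For
  \<open>0 \<notin> L\<close> the complementary minors contain row \<open>0\<close>; Laplace expansion along it writes the sum in
  question as a combination of the \<open>T K\<close> with coefficients \<open>minor * vandermonde / det\<close>.

  These coefficients grow at most like a fixed power of \<open>z\<close>. For the minors and the Vandermonde
  product this holds because meromorphic functions on a compact surface have polynomial growth at
  the points over infinity. The square of the determinant does not depend on the order of the
  sheets, hence is a meromorphic function of \<open>1 / z\<close> near \<open>0\<close>, and is therefore bounded below by a
  power of \<open>1 / z\<close> unless it vanishes identically; in the latter case the quotients are \<open>0\<close> by the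
  convention \<open>x / 0 = 0\<close>.\<close>

section \<open>Laplace expansion and the Koszul differential\<close>

definition rank_in :: "nat set \<Rightarrow> nat \<Rightarrow> nat" where
  "rank_in S j = card {i \<in> S. i < j}"

text \<open>An element is determined by how many elements of the set lie below it, and deleting
  \<open>pick S j\<close> lowers this count by one exactly for the elements enumerated after
  it.\<close>

lemma pick_remove:
  assumes S: "finite S" and j: "j < card S" and n: "n < card S - 1"
  shows "pick (S - {pick S j}) n = pick S (if n < j then n else Suc n)"
proof -
  define n' where "n' = (if n < j then n else Suc n)"
  define x where "x = pick S n'"
  have n': "n' < card S" using j n by (auto simp: n'_def)
  have x: "x \<in> S" "card {a \<in> S. a < x} = n'"
    unfolding x_def using n' by (auto intro: pick_in_set_le card_pick_le)
  have y: "pick S j \<in> S" "card {a \<in> S. a < pick S j} = j"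
    using j by (auto intro: pick_in_set_le card_pick_le)
  have nj: "n' \<noteq> j" by (auto simp: n'_def)
  with x y have xT: "x \<in> S - {pick S j}" by auto
  have less: "pick S j < x \<longleftrightarrow> j < n'"
  proof
    assume "j < n'" then show "pick S j < x" using pick_mono_le[OF n'] by (simp add: x_def)
  next
    assume "pick S j < x"
    show "j < n'"
    proof (rule ccontr)
      assume "\<not> j < n'"
      with nj have "n' < j" by simp
      with pick_mono_le[OF j this] \<open>pick S j < x\<close> show False by (simp add: x_def)
    qed
  qed
  have "{a \<in> S - {pick S j}. a < x} = {a \<in> S. a < x} - {pick S j}" by auto
  then have "card {a \<in> S - {pick S j}. a < x} = n"
    using x(2) less y(1) by (cases "pick S j < x") (auto simp: n'_def split: if_splits)
  with pick_card_in_set[OF xT] show ?thesis by (simp add: x_def n'_def)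
qed

text \<open>Makes the cofactors of a submatrix into minors of \<open>A\<close> itself, indexed by
  sets. The index shift of \<open>mat_delete\<close> is the one in
  \<open>pick_remove\<close>.\<close>

lemma mat_delete_submatrix:
  assumes I: "I \<subseteq> {..<dim_row A}" and J: "J \<subseteq> {..<dim_col A}"
    and i: "i < card I" and j: "j < card J"
  shows "mat_delete (submatrix A I J) i j = submatrix A (I - {pick I i}) (J - {pick J j})"
proof -
  have fin: "finite I" "finite J" using I J finite_subset by blast+
  have eq: "{x. x < n \<and> x \<in> S} = S" if "S \<subseteq> {..<n}" for n :: nat and S using that by auto
  have c: "card (I - {pick I i}) = card I - 1" "card (J - {pick J j}) = card J - 1"
    using fin i j pick_in_set_le by (simp_all add: card_Diff_singleton)
  have e1: "{x. x < dim_row A \<and> x \<in> I - {pick I i}} = I - {pick I i}"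
    "{x. x < dim_col A \<and> x \<in> J - {pick J j}} = J - {pick J j}"
    using I J by auto
  show ?thesis
    by (rule eq_matI)
       (auto simp: mat_delete_def submatrix_def eq[OF I] eq[OF J] e1 c pick_remove fin i j
          simp del: Diff_iff)
qed

lemma bij_betw_pick:
  assumes "finite S" shows "bij_betw (pick S) {..<card S} S"
proof (rule bij_betwI[where g = "rank_in S"])
  show "pick S \<in> {..<card S} \<rightarrow> S" by (auto intro: pick_in_set_le)
  show "rank_in S \<in> S \<rightarrow> {..<card S}"
    using assms by (auto simp: rank_in_def intro!: psubset_card_mono)
  show "rank_in S (pick S i) = i" if "i \<in> {..<card S}" for i
    using that by (auto simp: rank_in_def intro: card_pick_le)
  show "pick S (rank_in S i) = i" if "i \<in> S" for i
    using that by (auto simp: rank_in_def intro: pick_card_in_set)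
qed

text \<open>The usual expansion along a row, with the sum over positions reindexed by
  \<open>pick J\<close> to a sum over columns of \<open>A\<close>.\<close>

lemma laplace_expansion_submatrix_row:
  fixes A :: "'a :: comm_ring_1 mat"
  assumes I: "I \<subseteq> {..<dim_row A}" and J: "J \<subseteq> {..<dim_col A}"
    and card: "card I = card J" and r: "r \<in> I"
  shows "Determinant.det (submatrix A I J) =
    (\<Sum>j\<in>J. (-1) ^ (rank_in I r + rank_in J j) * A $$ (r, j) *
       Determinant.det (submatrix A (I - {r}) (J - {j})))"
proof -
  have fin: "finite I" "finite J" using I J finite_subset by blast+
  have eq: "{x. x < n \<and> x \<in> S} = S" if "S \<subseteq> {..<n}" for n :: nat and S using that by auto
  have rr: "rank_in I r < card I" "pick I (rank_in I r) = r"
    using fin r by (auto simp: rank_in_def intro!: psubset_card_mono pick_card_in_set)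
  have car: "submatrix A I J \<in> carrier_mat (card J) (card J)"
    by (auto simp: submatrix_def eq[OF I] eq[OF J] card)
  have "Determinant.det (submatrix A I J) =
      (\<Sum>j<card J. submatrix A I J $$ (rank_in I r, j) * cofactor (submatrix A I J) (rank_in I r) j)"
    using laplace_expansion_row[OF car, of "rank_in I r"] rr card by simp
  also have "\<dots> = (\<Sum>j<card J. (-1) ^ (rank_in I r + rank_in J (pick J j)) * A $$ (r, pick J j) *
       Determinant.det (submatrix A (I - {r}) (J - {pick J j})))"
  proof (rule sum.cong[OF refl])
    fix j assume "j \<in> {..<card J}"
    then have j: "j < card J" by simp
    then have "rank_in J (pick J j) = j" by (auto simp: rank_in_def intro: card_pick_le)
    then show "submatrix A I J $$ (rank_in I r, j) * cofactor (submatrix A I J) (rank_in I r) j =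
      (-1) ^ (rank_in I r + rank_in J (pick J j)) * A $$ (r, pick J j) *
       Determinant.det (submatrix A (I - {r}) (J - {pick J j}))"
      using rr j by (simp add: cofactor_def mat_delete_submatrix[OF I J] submatrix_index eq[OF I] eq[OF J])
  qed
  also have "\<dots> = (\<Sum>j\<in>J. (-1) ^ (rank_in I r + rank_in J j) * A $$ (r, j) *
       Determinant.det (submatrix A (I - {r}) (J - {j})))"
    by (rule sum.reindex_bij_betw[OF bij_betw_pick[OF fin(2)]])
  finally show ?thesis .
qed

section \<open>Sums over multi-indices and the Koszul differential\<close>

lemma finite_multi_indices [simp]: "finite (multi_indices m k)"
  by (simp add: multi_indices_def)

text \<open>Pairs \<open>(I, j)\<close> with \<open>j\<close> outside \<open>I\<close> correspond to
  pairs \<open>(K, j)\<close> with \<open>j\<close> in \<open>K\<close> through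
  \<open>K = insert j I\<close>.\<close>

lemma sum_multi_indices_insert:
  fixes h :: "nat set \<Rightarrow> nat \<Rightarrow> 'b :: comm_monoid_add"
  shows "(\<Sum>I\<in>multi_indices m k. \<Sum>j\<in>{0..m} - I. h I j) =
    (\<Sum>K\<in>multi_indices m (Suc k). \<Sum>j\<in>K. h (K - {j}) j)"
proof -
  have fin: "finite K" if "K \<in> multi_indices m n" for K n
    using that by (auto simp: multi_indices_def intro: finite_subset)
  have "(\<Sum>I\<in>multi_indices m k. \<Sum>j\<in>{0..m} - I. h I j) =
     (\<Sum>(I, j)\<in>(SIGMA I:multi_indices m k. {0..m} - I). h I j)"
    by (intro sum.Sigma) auto
  also have "\<dots> = (\<Sum>(K, j)\<in>(SIGMA K:multi_indices m (Suc k). K). h (K - {j}) j)"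
    by (rule sum.reindex_bij_witness[where i = "\<lambda>(K, j). (K - {j}, j)" and j = "\<lambda>(I, j). (insert j I, j)"])
       (auto simp: multi_indices_def card_Diff_singleton finite_subset[of _ "{0..m}"] insert_absorb)
  also have "\<dots> = (\<Sum>K\<in>multi_indices m (Suc k). \<Sum>j\<in>K. h (K - {j}) j)"
    using fin by (intro sum.Sigma[symmetric]) auto
  finally show ?thesis .
qed

text \<open>The coefficient at \<open>K\<close> of the exterior product of the 1-form with
  coefficients \<open>a\<close> and the form with coefficients \<open>P\<close>.\<close>

definition koszul :: "(nat set \<Rightarrow> 'b) \<Rightarrow> (nat \<Rightarrow> 'b) \<Rightarrow> nat set \<Rightarrow> 'b :: comm_ring_1" where
  "koszul P a K = (\<Sum>j\<in>K. (-1) ^ rank_in K j * P (K - {j}) * a j)"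

lemma rank_in_remove:
  assumes "finite K" "j \<in> K"
  shows "rank_in K i = rank_in (K - {j}) i + (if j < i then 1 else 0)"
proof -
  have "{a \<in> K - {j}. a < i} = {a \<in> K. a < i} - {j}" by auto
  moreover have "card {a \<in> K. a < i} > 0" if "j < i"
    using that assms by (auto simp: card_gt_0_iff)
  ultimately show ?thesis using assms by (auto simp: rank_in_def card_Diff_singleton)
qed

text \<open>Relates the sign of \<open>j\<close> in a Laplace expansion, where ranks are taken in
  the complement of \<open>I\<close>, to its sign in \<open>koszul\<close>. There are
  \<open>j\<close> numbers below \<open>j\<close>, and each lies in \<open>I\<close> or in its
  complement.\<close>

lemma rank_in_complement:
  assumes "I \<subseteq> {0..m}" "j \<in> {0..m}"
  shows "rank_in I j + rank_in ({0..m} - I) j = j"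
proof -
  have "card ({i \<in> I. i < j} \<union> {i \<in> {0..m} - I. i < j}) = rank_in I j + rank_in ({0..m} - I) j"
    unfolding rank_in_def using assms
    by (intro card_Un_disjoint) (auto simp: finite_subset[of _ "{0..m}"])
  moreover have "{i \<in> I. i < j} \<union> {i \<in> {0..m} - I. i < j} = {..<j}" using assms by auto
  ultimately show ?thesis by simp
qed

text \<open>Row \<open>0\<close> is among the remaining rows of every minor, because
  \<open>0\<close> is not in \<open>L\<close>. After expansion along it, all terms with the same
  column set \<open>K = insert j I\<close> share one minor, and its cofactor is a
  \<open>koszul\<close> coefficient formed with row \<open>0\<close>.\<close>

lemma sum_algebraic_complement:
  fixes M :: "complex Matrix.mat"
  assumes M: "M \<in> carrier_mat (m + 1) (m + 1)" and L: "L \<in> multi_indices m k" and L0: "0 \<notin> L"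
  shows "(\<Sum>I\<in>multi_indices m k. P I * algebraic_complement M L I) =
    (\<Sum>K\<in>multi_indices m (Suc k). (-1) ^ (\<Sum>K + \<Sum>L) *
       Determinant.det (submatrix M ({0..m} - L - {0}) ({0..m} - K)) * koszul P (\<lambda>j. M $$ (0, j)) K)"
proof -
  let ?d = "\<lambda>K. Determinant.det (submatrix M ({0..m} - L - {0}) ({0..m} - K))"
  have dim: "dim_row M = m + 1" "dim_col M = m + 1" using M by auto
  have set: "{0..<m + 1} = {0..m}" by auto
  have "P I * algebraic_complement M L I =
     (\<Sum>j\<in>{0..m} - I. (-1) ^ (\<Sum>(insert j I) + \<Sum>L) * (-1) ^ rank_in (insert j I) j *
        P I * M $$ (0, j) * ?d (insert j I))" if I: "I \<in> multi_indices m k" for I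
  proof -
    have I': "I \<subseteq> {0..m}" "finite I" using I by (auto simp: multi_indices_def finite_subset[of _ "{0..m}"])
    have card: "card ({0..m} - L) = card ({0..m} - I)"
      using I L by (auto simp: multi_indices_def card_Diff_subset finite_subset[of _ "{0..m}"])
    \<comment> \<open>Row \<open>0\<close> comes first among the remaining rows and contributes no
      sign.\<close>
    have r0: "rank_in ({0..m} - L) 0 = 0" by (simp add: rank_in_def)
    have "P I * algebraic_complement M L I = P I * ((-1) ^ (\<Sum>I + \<Sum>L) *
       (\<Sum>j\<in>{0..m} - I. (-1) ^ rank_in ({0..m} - I) j * M $$ (0, j) *
         Determinant.det (submatrix M ({0..m} - L - {0}) ({0..m} - I - {j}))))"
      unfolding algebraic_complement_def dim set
      by (subst laplace_expansion_submatrix_row[where r = 0]) (use card L0 dim in \<open>auto simp: r0\<close>)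
    also have "\<dots> = (\<Sum>j\<in>{0..m} - I. P I * ((-1) ^ (\<Sum>I + \<Sum>L) * ((-1) ^ rank_in ({0..m} - I) j * M $$ (0, j) *
         Determinant.det (submatrix M ({0..m} - L - {0}) ({0..m} - I - {j})))))"
      by (simp add: sum_distrib_left)
    also have "\<dots> = (\<Sum>j\<in>{0..m} - I. (-1) ^ (\<Sum>(insert j I) + \<Sum>L) * (-1) ^ rank_in (insert j I) j *
        P I * M $$ (0, j) * ?d (insert j I))"
    proof (rule sum.cong[OF refl])
      fix j assume j: "j \<in> {0..m} - I"
      have "rank_in (insert j I) j = rank_in I j"
        unfolding rank_in_def by (rule arg_cong[where f = card]) auto
      \<comment> \<open>Adding column \<open>j\<close> raises the column sum by \<open>j\<close>,
        the sum of the ranks of \<open>j\<close> in \<open>I\<close> and in its complement. The rank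
        in \<open>I\<close> cancels modulo 2 against the sign in \<open>koszul\<close>, which leaves
        the Laplace sign.\<close>
      moreover have "\<Sum>(insert j I) = rank_in I j + rank_in ({0..m} - I) j + \<Sum>I"
        using rank_in_complement[OF I'(1), of j] j I' by simp
      ultimately have "(-1 :: complex) ^ (\<Sum>(insert j I) + \<Sum>L) * (-1) ^ rank_in (insert j I) j =
         (-1) ^ (\<Sum>I + \<Sum>L) * (-1) ^ rank_in ({0..m} - I) j * ((-1) ^ rank_in I j * (-1) ^ rank_in I j)"
        by (simp only: power_add ac_simps)
      also have "(-1 :: complex) ^ rank_in I j * (-1) ^ rank_in I j = 1"
        by (simp flip: power_add)
      finally have sgn: "(-1 :: complex) ^ (\<Sum>(insert j I) + \<Sum>L) * (-1) ^ rank_in (insert j I) j =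
         (-1) ^ (\<Sum>I + \<Sum>L) * (-1) ^ rank_in ({0..m} - I) j" by simp
      have "{0..m} - I - {j} = {0..m} - insert j I" by auto
      with sgn show "P I * ((-1) ^ (\<Sum>I + \<Sum>L) * ((-1) ^ rank_in ({0..m} - I) j * M $$ (0, j) *
         Determinant.det (submatrix M ({0..m} - L - {0}) ({0..m} - I - {j})))) =
         (-1) ^ (\<Sum>(insert j I) + \<Sum>L) * (-1) ^ rank_in (insert j I) j * P I * M $$ (0, j) * ?d (insert j I)"
        by (simp add: mult_ac)
    qed
    finally show ?thesis .
  qed
  then have "(\<Sum>I\<in>multi_indices m k. P I * algebraic_complement M L I) =
    (\<Sum>I\<in>multi_indices m k. \<Sum>j\<in>{0..m} - I. (-1) ^ (\<Sum>(insert j I) + \<Sum>L) *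
       (-1) ^ rank_in (insert j I) j * P I * M $$ (0, j) * ?d (insert j I))"
    by (intro sum.cong) auto
  also have "\<dots> = (\<Sum>K\<in>multi_indices m (Suc k). \<Sum>j\<in>K. (-1) ^ (\<Sum>(insert j (K - {j})) + \<Sum>L) *
       (-1) ^ rank_in (insert j (K - {j})) j * P (K - {j}) * M $$ (0, j) * ?d (insert j (K - {j})))"
    by (rule sum_multi_indices_insert)
  also have "\<dots> = (\<Sum>K\<in>multi_indices m (Suc k). (-1) ^ (\<Sum>K + \<Sum>L) * ?d K * koszul P (\<lambda>j. M $$ (0, j)) K)"
    by (intro sum.cong refl) (auto simp: koszul_def sum_distrib_left insert_absorb mult_ac intro!: sum.cong)
  finally show ?thesis .
qed

text \<open>As \<open>0\<close> comes first, its own sign is positive and it raises every other rank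
  by one, which reverses the remaining signs.\<close>

lemma koszul_insert_0:
  assumes "finite J" "0 \<notin> J" "a 0 = 1"
  shows "koszul P a (insert 0 J) =
    P J - (\<Sum>i\<in>J. (-1) ^ rank_in J i * P (insert 0 (J - {i})) * a i)"
proof -
  have "rank_in (insert 0 J) i = Suc (rank_in J i)" if "i \<in> J" for i
    using rank_in_remove[of "insert 0 J" 0 i] assms that by (cases "i = 0") auto
  moreover have "rank_in (insert 0 J) 0 = 0" by (simp add: rank_in_def)
  moreover have "insert 0 J - {i} = insert 0 (J - {i})" if "i \<in> J" for i
    using that assms by auto
  moreover have "insert 0 J - {0} = J" using assms by auto
  ultimately show ?thesis using assms by (simp add: koszul_def sum_negf)
qed

text \<open>The Koszul differential squares to zero, so the values at the sets without \<open>0\<close> are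
  combinations of those at the sets containing \<open>0\<close>.\<close>

lemma koszul_eq_sum_koszul_insert_0:
  fixes a :: "nat \<Rightarrow> 'b :: {idom, ring_char_0}"
  assumes K: "finite K" "0 \<notin> K" and a: "a 0 = 1"
  shows "koszul P a K = (\<Sum>j\<in>K. (-1) ^ rank_in K j * a j * koszul P a (insert 0 (K - {j})))"
proof -
  \<comment> \<open>The term of the iterated differential in which first \<open>j\<close> and then
    \<open>i\<close> is removed.\<close>
  define t where "t j i = (-1) ^ (rank_in K j + rank_in (K - {j}) i) * a j * a i * P (insert 0 (K - {j} - {i}))" for j i
  define S where "S = (\<Sum>(j, i)\<in>(SIGMA j:K. K - {j}). t j i)"
  \<comment> \<open>The larger of the two elements loses one in rank when the smaller is removed
    first, while the rank of the smaller is unaffected by the order; so the two signs are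
    opposite.\<close>
  have anti: "t i j = - t j i" if ij: "i \<in> K" "j \<in> K" "i \<noteq> j" for i j
  proof -
    have eqs: "rank_in K i = rank_in (K - {j}) i + (if j < i then 1 else 0)"
      "rank_in K j = rank_in (K - {i}) j + (if i < j then 1 else 0)"
      using rank_in_remove K ij by blast+
    have "K - {i} - {j} = K - {j} - {i}" by auto
    then show ?thesis using ij unfolding t_def eqs
      by (cases "i < j") (auto simp: power_add mult_ac)
  qed
  \<comment> \<open>Swapping the two indices permutes the index set, so \<open>S\<close> equals its
    own negative and vanishes in characteristic \<open>0\<close>.\<close>
  have "S = (\<Sum>(j, i)\<in>(SIGMA j:K. K - {j}). t i j)"
    unfolding S_def
    by (rule sum.reindex_bij_witness[where i = "\<lambda>(j, i). (i, j)" and j = "\<lambda>(j, i). (i, j)"]) auto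
  also have "\<dots> = (\<Sum>(j, i)\<in>(SIGMA j:K. K - {j}). - t j i)"
    by (rule sum.cong) (auto intro: anti)
  also have "\<dots> = - S" by (simp add: S_def sum_negf case_prod_unfold)
  finally have "S = 0" by simp
  have "(\<Sum>j\<in>K. (-1) ^ rank_in K j * a j * koszul P a (insert 0 (K - {j}))) =
     (\<Sum>j\<in>K. (-1) ^ rank_in K j * a j * P (K - {j}) - (\<Sum>i\<in>K - {j}. t j i))"
  proof (rule sum.cong[OF refl])
    fix j assume "j \<in> K"
    have "koszul P a (insert 0 (K - {j})) = P (K - {j}) -
       (\<Sum>i\<in>K - {j}. (-1) ^ rank_in (K - {j}) i * P (insert 0 (K - {j} - {i})) * a i)"
      using K a by (intro koszul_insert_0) auto
    then show "(-1) ^ rank_in K j * a j * koszul P a (insert 0 (K - {j})) =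
       (-1) ^ rank_in K j * a j * P (K - {j}) - (\<Sum>i\<in>K - {j}. t j i)"
      by (simp add: right_diff_distrib sum_distrib_left t_def power_add mult_ac)
  qed
  also have "\<dots> = koszul P a K - (\<Sum>j\<in>K. \<Sum>i\<in>K - {j}. t j i)"
    by (simp add: koszul_def sum_subtractf mult_ac)
  also have "(\<Sum>j\<in>K. \<Sum>i\<in>K - {j}. t j i) = S"
    unfolding S_def using K by (intro sum.Sigma) auto
  finally show ?thesis using \<open>S = 0\<close> by simp
qed

text \<open>The entry with number \<open>s\<close> has rank \<open>s - 1\<close> in
  \<open>J\<close>, hence rank \<open>s\<close> in \<open>insert 0 J\<close>; so the signs in the
  defining relation of the Hermite--Pade polynomials are those of \<open>koszul\<close>.\<close>

lemma hermite_pade_sum_eq_koszul: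
  fixes P a :: "_ \<Rightarrow> complex"
  assumes J: "J \<in> multi_indices m k" "0 \<notin> J" and a: "a 0 = 1"
  shows "P J + (\<Sum>s=1..k. (-1) ^ s * P (insert 0 (J - {sorted_list_of_set J ! (s - 1)})) *
            a (sorted_list_of_set J ! (s - 1))) = koszul P a (insert 0 J)"
proof -
  let ?l = "sorted_list_of_set J"
  have fin: "finite J" and card: "card J = k"
    using J by (auto simp: multi_indices_def finite_subset[of _ "{0..m}"])
  have bij: "bij_betw (\<lambda>i. ?l ! i) {..<k} J"
    using bij_betw_nth[of ?l "{..<k}" J] fin card by simp
  have rank: "rank_in J (?l ! i) = i" if "i < k" for i
  proof -
    have inc: "?l ! a < ?l ! b \<longleftrightarrow> a < b" if "a < k" "b < k" for a b
      using that card strict_sorted_list_of_set[of J]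
      by (metis length_sorted_list_of_set linorder_neqE_nat not_less_iff_gr_or_eq sorted_wrt_iff_nth_less)
    have "{a \<in> J. a < ?l ! i} = (\<lambda>i. ?l ! i) ` {..<i}"
    proof -
      have J': "J = (\<lambda>i. ?l ! i) ` {..<k}" using bij by (simp add: bij_betw_def)
      show ?thesis
      proof (intro equalityI subsetI)
        fix x assume "x \<in> {a \<in> J. a < ?l ! i}"
        then obtain b where "b < k" "x = ?l ! b" "?l ! b < ?l ! i" using J' by auto
        then show "x \<in> (\<lambda>i. ?l ! i) ` {..<i}" using inc that by auto
      next
        fix x assume "x \<in> (\<lambda>i. ?l ! i) ` {..<i}"
        then obtain b where "b < i" "x = ?l ! b" by auto
        then show "x \<in> {a \<in> J. a < ?l ! i}" using inc that bij_betwE[OF bij] by auto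
      qed
    qed
    moreover have "inj_on (\<lambda>i. ?l ! i) {..<i}"
      using bij that by (auto simp: bij_betw_def intro: inj_on_subset)
    ultimately show ?thesis by (simp add: rank_in_def card_image)
  qed
  have "(\<Sum>s=1..k. (-1) ^ s * P (insert 0 (J - {?l ! (s - 1)})) * a (?l ! (s - 1))) =
     (\<Sum>i<k. - ((-1) ^ i * P (insert 0 (J - {?l ! i})) * a (?l ! i)))"
    by (rule sum.reindex_bij_witness[where i = Suc and j = "\<lambda>s. s - 1"])
       (auto simp: power_eq_if split: if_splits)
  also have "\<dots> = (\<Sum>i<k. - ((-1) ^ rank_in J (?l ! i) * P (insert 0 (J - {?l ! i})) * a (?l ! i)))"
    by (rule sum.cong) (auto simp: rank)
  also have "\<dots> = (\<Sum>j\<in>J. - ((-1) ^ rank_in J j * P (insert 0 (J - {j})) * a j))"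
    by (rule sum.reindex_bij_betw[OF bij])
  finally show ?thesis using koszul_insert_0[of J a P] fin J a by (simp add: sum_negf)
qed

section \<open>Determinants\<close>

lemma norm_det_le:
  fixes A :: "complex Matrix.mat"
  assumes A: "A \<in> carrier_mat n n" and B: "\<And>i j. i < n \<Longrightarrow> j < n \<Longrightarrow> cmod (A $$ (i, j)) \<le> B"
  shows "cmod (Determinant.det A) \<le> fact n * B ^ n"
proof -
  have "cmod (Determinant.det A) =
      cmod (\<Sum>p | p permutes {0..<n}. signof p * (\<Prod>i = 0..<n. A $$ (i, p i)))"
    using det_def'[OF A] by simp
  also have "\<dots> \<le> (\<Sum>p | p permutes {0..<n}. B ^ n)"
  proof (rule sum_norm_le)
    fix p assume "p \<in> {p. p permutes {0..<n}}"
    then have p: "p permutes {0..<n}" by simp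
    have "cmod (signof p * (\<Prod>i = 0..<n. A $$ (i, p i))) = (\<Prod>i = 0..<n. cmod (A $$ (i, p i)))"
      by (simp add: norm_mult prod_norm sign_def)
    also have "\<dots> \<le> (\<Prod>i = 0..<n. B)"
      using permutes_in_image[OF p] by (intro prod_mono) (auto intro!: B)
    finally show "cmod (signof p * (\<Prod>i = 0..<n. A $$ (i, p i))) \<le> B ^ n" by simp
  qed
  also have "\<dots> = fact n * B ^ n" by (simp add: card_permutations[of _ n])
  finally show ?thesis .
qed

lemma det_analytic_at:
  fixes A :: "complex \<Rightarrow> complex Matrix.mat"
  assumes A: "\<And>v. A v \<in> carrier_mat n n"
    and an: "\<And>i j. i < n \<Longrightarrow> j < n \<Longrightarrow> (\<lambda>v. A v $$ (i, j)) analytic_on S"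
  shows "(\<lambda>v. Determinant.det (A v)) analytic_on S"
proof -
  have "(\<lambda>v. \<Sum>p | p permutes {0..<n}. signof p * (\<Prod>i = 0..<n. A v $$ (i, p i))) analytic_on S"
  proof (intro analytic_on_sum analytic_on_mult analytic_on_const analytic_on_prod)
    fix p i assume "p \<in> {p. p permutes {0..<n}}" "i \<in> {0..<n}"
    then show "(\<lambda>v. A v $$ (i, p i)) analytic_on S"
      using permutes_in_image[of p "{0..<n}" i] by (intro an) auto
  qed
  then show ?thesis by (simp add: det_def'[OF A])
qed

lemma system_matrix_carrier [simp]: "system_matrix m f e \<in> carrier_mat (m + 1) (m + 1)"
  by (simp add: system_matrix_def)

lemma system_matrix_index [simp]:
  "i \<le> m \<Longrightarrow> j \<le> m \<Longrightarrow> system_matrix m f e $$ (i, j) = col f j (e i)"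
  by (simp add: system_matrix_def)

text \<open>Two enumerations of \<open>S\<close> differ by a permutation of the rows, and squaring
  removes its sign.\<close>

lemma det_system_matrix_power2_eq:
  assumes "bij_betw e {0..m} S" "bij_betw e' {0..m} S"
  shows "(Determinant.det (system_matrix m f e))\<^sup>2 = (Determinant.det (system_matrix m f e'))\<^sup>2"
proof -
  \<comment> \<open>The transition between the enumerations, extended by the identity as
    \<open>permutes\<close> demands.\<close>
  define p where "p i = (if i \<in> {0..m} then inv_into {0..m} e (e' i) else i)" for i
  have "bij_betw (inv_into {0..m} e \<circ> e') {0..m} {0..m}"
    using assms by (intro bij_betw_trans[OF assms(2)] bij_betw_inv_into)
  then have "bij_betw p {0..m} {0..m}"
    by (rule bij_betw_cong[THEN iffD1, rotated]) (simp add: p_def)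
  then have p: "p permutes {0..<m + 1}"
    using bij_imp_permutes[of p "{0..<m + 1}"] by (auto simp: p_def atLeastLessThanSuc_atLeastAtMost)
  have ep: "e (p i) = e' i" if "i \<le> m" for i
    using that assms unfolding bij_betw_def
    by (metis atLeastAtMost_iff f_inv_into_f imageI p_def zero_le)
  have "p i < m + 1" if "i < m + 1" for i using permutes_in_image[OF p, of i] that by simp
  then have "system_matrix m f e' = Matrix.mat (m + 1) (m + 1) (\<lambda>(i, j). system_matrix m f e $$ (p i, j))"
    by (intro eq_matI) (auto simp: system_matrix_def ep)
  then have "Determinant.det (system_matrix m f e') = signof p * Determinant.det (system_matrix m f e)"
    using det_permute_rows[OF system_matrix_carrier p] by simp
  then show ?thesis by (simp add: power_mult_distrib sign_def)
qed

lemma norm_det_submatrix_le: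
  fixes A :: "complex Matrix.mat"
  assumes I: "I \<subseteq> {..<dim_row A}" "card I = n" and J: "J \<subseteq> {..<dim_col A}" "card J = n"
    and B: "\<And>i j. i \<in> I \<Longrightarrow> j \<in> J \<Longrightarrow> cmod (A $$ (i, j)) \<le> B"
  shows "cmod (Determinant.det (submatrix A I J)) \<le> fact n * B ^ n"
proof (rule norm_det_le)
  have eq: "{x. x < n \<and> x \<in> S} = S" if "S \<subseteq> {..<n}" for n :: nat and S using that by auto
  show "submatrix A I J \<in> carrier_mat n n"
    using I J by (simp add: submatrix_def eq)
  show "cmod (submatrix A I J $$ (i, j)) \<le> B" if "i < n" "j < n" for i j
    using that I J by (simp add: submatrix_index eq B pick_in_set_le)
qed

text \<open>To get an exponent independent of \<open>L\<close>, the number of factors is estimated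
  by the number of all pairs of indices; \<open>1 \<le> B\<close> allows the exponent to be
  raised.\<close>

lemma vandermonde_product_bound:
  assumes L: "L \<subseteq> {0..m}" and B: "\<And>i. i \<in> L \<Longrightarrow> cmod (the (w (e i))) \<le> B" "1 \<le> B"
  shows "cmod (vandermonde_product w e L) \<le> (2 * B) ^ (m + 1)\<^sup>2"
proof -
  let ?T = "{(i, j). i \<in> L \<and> j \<in> L \<and> i < j}"
  have sub: "?T \<subseteq> {0..m} \<times> {0..m}" using L by auto
  then have "card ?T \<le> card ({0..m} \<times> {0..m})" by (intro card_mono) auto
  then have card: "card ?T \<le> (m + 1)\<^sup>2" by (simp add: power2_eq_square)
  have "cmod (vandermonde_product w e L) = (\<Prod>(i, j)\<in>?T. cmod (the (w (e j)) - the (w (e i))))"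
    by (simp add: vandermonde_product_def prod_norm[symmetric] case_prod_unfold)
  also have "\<dots> \<le> (\<Prod>(i, j)\<in>?T. 2 * B)"
  proof (rule prod_mono)
    fix ij assume "ij \<in> ?T"
    then obtain i j where ij: "ij = (i, j)" "i \<in> L" "j \<in> L" by auto
    have "cmod (the (w (e j)) - the (w (e i))) \<le> cmod (the (w (e j))) + cmod (the (w (e i)))"
      by (rule norm_triangle_ineq4)
    also have "\<dots> \<le> 2 * B" using B(1)[OF ij(2)] B(1)[OF ij(3)] by linarith
    finally show "0 \<le> (case ij of (i, j) \<Rightarrow> cmod (the (w (e j)) - the (w (e i)))) \<and>
      (case ij of (i, j) \<Rightarrow> cmod (the (w (e j)) - the (w (e i)))) \<le> (case ij of (i, j) \<Rightarrow> 2 * B)"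
      by (simp add: ij)
  qed
  also have "\<dots> = (2 * B) ^ card ?T" by (simp add: case_prod_unfold)
  also have "\<dots> \<le> (2 * B) ^ (m + 1)\<^sup>2" using card B(2) by (intro power_increasing) auto
  finally show ?thesis .
qed

section \<open>Meromorphic functions near a point\<close>

lemma meromorphic_at_upper_bound:
  assumes "f meromorphic_on {z0}"
  shows "\<exists>N::nat. \<forall>\<^sub>F w in at z0. cmod (f w) * cmod (w - z0) ^ N \<le> 1"
proof (cases "\<exists>\<^sub>F w in at z0. f w \<noteq> 0")
  \<comment> \<open>The order \<open>zorder\<close> is meaningful only for functions that do not
    vanish identically near \<open>z0\<close>; for the others the exponent \<open>0\<close>
    works.\<close>
  case False
  then have "\<forall>\<^sub>F w in at z0. f w = 0" by (simp add: not_frequently)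
  then show ?thesis by (intro exI[of _ 0]) (auto elim!: eventually_mono)
next
  case True
  define n where "n = zorder f z0"
  define g where "g = zor_poly f z0"
  obtain r where r: "r > 0" "g holomorphic_on cball z0 r"
    "\<And>w. w \<in> cball z0 r - {z0} \<Longrightarrow> f w = g w * (w - z0) powi n"
    using zorder_exist[of f z0] assms True
    unfolding meromorphic_at_iff n_def g_def by blast
  \<comment> \<open>This makes the total order \<open>M = n + N\<close> at least \<open>1\<close>,
    so \<open>f w * (w - z0) ^ N\<close> tends to \<open>0\<close> and is eventually bounded by
    \<open>1\<close> without a further constant.\<close>
  define N where "N = nat (1 - n)"
  define M where "M = nat (n + int N)"
  have M: "M > 0" "n + int N = int M" by (auto simp: M_def N_def)
  have cont: "isCont g z0"
    using r(2) holomorphic_on_imp_continuous_on[of g "cball z0 r"] continuous_on_interior[of "cball z0 r" g z0] r(1)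
    by simp
  have "((\<lambda>w. g w * (w - z0) ^ M) \<longlongrightarrow> g z0 * (z0 - z0) ^ M) (at z0)"
    using cont by (intro tendsto_intros) (auto simp: isCont_def)
  then have "((\<lambda>w. g w * (w - z0) ^ M) \<longlongrightarrow> 0) (at z0)" using M by (simp add: zero_power)
  then have "\<forall>\<^sub>F w in at z0. cmod (g w * (w - z0) ^ M) < 1"
    by (simp add: tendsto_iff dist_norm)
  moreover have "\<forall>\<^sub>F w in at z0. w \<in> cball z0 r - {z0}"
    using r(1) by (auto simp: eventually_at dist_commute intro!: exI[of _ r])
  ultimately have "\<forall>\<^sub>F w in at z0. cmod (f w) * cmod (w - z0) ^ N \<le> 1"
  proof eventually_elim
    case (elim w)
    have "f w * (w - z0) ^ N = g w * (w - z0) powi (n + int N)"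
      using elim r(3)[of w] by (simp add: power_int_add)
    also have "\<dots> = g w * (w - z0) ^ M" by (simp add: M)
    finally show ?case using elim by (simp flip: norm_power norm_mult)
  qed
  then show ?thesis by blast
qed

text \<open>The upper bound for the reciprocal, together with the isolation of zeros.\<close>

lemma meromorphic_at_lower_bound:
  assumes "f meromorphic_on {z0}" "\<exists>\<^sub>F w in at z0. f w \<noteq> 0"
  shows "\<exists>N::nat. \<forall>\<^sub>F w in at z0. f w \<noteq> 0 \<and> cmod (w - z0) ^ N \<le> cmod (f w)"
proof -
  have "(\<lambda>w. inverse (f w)) meromorphic_on {z0}"
    using assms(1) by (intro meromorphic_intros)
  then obtain N where N: "\<forall>\<^sub>F w in at z0. cmod (inverse (f w)) * cmod (w - z0) ^ N \<le> 1"
    using meromorphic_at_upper_bound by blast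
  moreover have "\<forall>\<^sub>F w in at z0. f w \<noteq> 0"
    using assms non_zero_neighbour by (simp add: meromorphic_at_iff)
  ultimately have "\<forall>\<^sub>F w in at z0. f w \<noteq> 0 \<and> cmod (w - z0) ^ N \<le> cmod (f w)"
    by eventually_elim (simp only: norm_inverse, simp add: divide_simps mult.commute)
  then show ?thesis by blast
qed

section \<open>Isolated zeros and isolated singularities\<close>

lemma analytic_at_eventually_zero_or_nonzero:
  assumes "f analytic_on {z}"
  shows "(\<forall>\<^sub>F w in at z. f w = 0) \<or> (\<forall>\<^sub>F w in at z. f w \<noteq> 0)"
proof (cases "\<exists>\<^sub>F w in at z. f w \<noteq> 0")
  case True
  then show ?thesis
    using assms non_zero_neighbour isolated_singularity_at_analytic not_essential_analytic by blast
qed (simp add: not_frequently)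

text \<open>Otherwise the derivative would vanish identically near \<open>c\<close>, and
  \<open>G\<close> would be constant there with value \<open>G c = 0\<close>.\<close>

lemma deriv_nonzero_near_zero:
  assumes "G analytic_on {c}" "\<forall>\<^sub>F \<zeta> in at c. G \<zeta> \<noteq> 0" "G c = 0"
  shows "\<forall>\<^sub>F \<zeta> in at c. deriv G \<zeta> \<noteq> 0"
proof (rule ccontr)
  assume no: "\<not> ?thesis"
  have "deriv G analytic_on {c}" using assms(1) by (rule analytic_deriv)
  with no have "\<forall>\<^sub>F \<zeta> in at c. deriv G \<zeta> = 0"
    using analytic_at_eventually_zero_or_nonzero by blast
  then obtain d where d: "d > 0" "\<And>\<zeta>. \<zeta> \<noteq> c \<Longrightarrow> dist \<zeta> c < d \<Longrightarrow> deriv G \<zeta> = 0"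
    by (auto simp: eventually_at)
  obtain S where S: "open S" "c \<in> S" "G holomorphic_on S" using assms(1) analytic_at by blast
  then obtain r where r: "r > 0" "ball c r \<subseteq> S" by (meson openE)
  define e where "e = min r d"
  have hol: "G holomorphic_on ball c e" using S(3) by (rule holomorphic_on_subset) (use r in \<open>auto simp: e_def\<close>)
  have "\<And>\<zeta>. \<zeta> \<in> ball c e - {c} \<Longrightarrow> (G has_field_derivative 0) (at \<zeta>)"
    using holomorphic_derivI[OF hol open_ball] d by (fastforce simp: e_def dist_commute)
  then obtain k where "\<And>\<zeta>. \<zeta> \<in> ball c e \<Longrightarrow> G \<zeta> = k"
    using DERIV_zero_connected_constant[of "ball c e" "{c}" G] holomorphic_on_imp_continuous_on[OF hol]
    by (metis connected_ball open_ball finite.emptyI finite_insert)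
  then have "\<And>\<zeta>. \<zeta> \<in> ball c e \<Longrightarrow> G \<zeta> = 0"
    using assms(3) r d by (metis centre_in_ball e_def min_less_iff_conj)
  moreover have "\<forall>\<^sub>F \<zeta> in at c. \<zeta> \<in> ball c e"
    using r d by (intro eventually_at_in_open') (auto simp: e_def)
  ultimately have "\<forall>\<^sub>F \<zeta> in at c. G \<zeta> = 0" by (auto elim: eventually_mono)
  with assms(2) have "\<forall>\<^sub>F \<zeta> in at c. False" by eventually_elim simp
  then show False by simp
qed

lemma meromorphic_at_imp_eventually_analytic:
  assumes "f meromorphic_on {c}"
  shows "\<forall>\<^sub>F \<zeta> in at c. f analytic_on {\<zeta>}"
proof -
  obtain r where r: "r > 0" "f analytic_on ball c r - {c}"
    using assms by (auto simp: meromorphic_at_iff isolated_singularity_at_def)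
  have "\<forall>\<^sub>F \<zeta> in at c. \<zeta> \<in> ball c r - {c}" using r(1)
    by (intro eventually_at_in_open) auto
  then show ?thesis by eventually_elim (use r(2) in \<open>auto intro: analytic_on_subset\<close>)
qed

lemma eventually_at_0_iff_at_infinity:
  fixes P :: "complex \<Rightarrow> bool"
  shows "(\<forall>\<^sub>F v in at 0. P v) \<longleftrightarrow> (\<forall>\<^sub>F z in at_infinity. P (inverse z))"
  by (simp add: at_to_infinity eventually_filtermap)

text \<open>A punctured open neighbourhood of \<open>c\<close> is a neighbourhood of each of its
  points.\<close>

lemma eventually_at_imp_eventually_nhds:
  fixes P :: "complex \<Rightarrow> bool"
  assumes "\<forall>\<^sub>F v in at c. P v"
  shows "\<forall>\<^sub>F v in at c. \<forall>\<^sub>F v' in nhds v. P v'"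
proof -
  obtain S where S: "open S" "c \<in> S" "\<And>v. v \<in> S \<Longrightarrow> v \<noteq> c \<Longrightarrow> P v"
    using assms unfolding eventually_at_topological by blast
  have "\<forall>\<^sub>F v' in nhds v. P v'" if "v \<in> S" "v \<noteq> c" for v
  proof -
    have "\<forall>\<^sub>F v' in nhds v. v' \<in> S - {c}" using S that by (intro eventually_nhds_in_open) auto
    then show ?thesis by eventually_elim (use S in auto)
  qed
  with S show ?thesis unfolding eventually_at_topological by blast
qed

text \<open>One factor \<open>v\<close> more than in the bound forces the limit \<open>0\<close>, so
  \<open>h\<close> has no essential singularity at \<open>0\<close>; division by a power of
  \<open>v\<close> preserves meromorphy.\<close>

lemma meromorphic_at_0_if_bounded:
  assumes an: "\<forall>\<^sub>F v in at 0. f analytic_on {v}"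
    and bd: "\<forall>\<^sub>F v in at 0. cmod (f v) * cmod v ^ N \<le> B"
  shows "f meromorphic_on {0}"
proof -
  define h where "h v = f v * v ^ Suc N" for v
  obtain S where S: "open S" "0 \<in> S" "\<And>v. v \<in> S \<Longrightarrow> v \<noteq> 0 \<Longrightarrow> f analytic_on {v}"
    using an unfolding eventually_at_topological by blast
  obtain r where r: "r > 0" "ball 0 r \<subseteq> S" using S openE by blast
  have "f analytic_on ball 0 r - {0}"
    using S(3) r by (subst analytic_on_analytic_at) blast
  then have "h analytic_on ball 0 r - {0}" unfolding h_def by (intro analytic_intros)
  then have iso: "isolated_singularity_at h 0" using r by (auto simp: isolated_singularity_at_def)
  have "(h \<longlongrightarrow> 0) (at 0)"
  proof (rule Lim_null_comparison)
    show "\<forall>\<^sub>F v in at 0. cmod (h v) \<le> B * cmod v"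
      using bd
    proof eventually_elim
      case (elim v)
      have "cmod (h v) = (cmod (f v) * cmod v ^ N) * cmod v"
        by (simp add: h_def norm_mult norm_power mult_ac)
      also have "\<dots> \<le> B * cmod v" using elim by (intro mult_right_mono) auto
      finally show ?case .
    qed
    show "((\<lambda>v. B * cmod v) \<longlongrightarrow> 0) (at 0)"
      by (auto intro!: tendsto_eq_intros)
  qed
  then have "not_essential h 0" by (auto simp: not_essential_def)
  with iso have "h meromorphic_on {0}" by (simp add: meromorphic_at_iff)
  then have "(\<lambda>v. h v / v ^ Suc N) meromorphic_on {0}" by (intro meromorphic_intros)
  moreover have "\<forall>\<^sub>F v in at 0. h v / v ^ Suc N = f v"
    by (auto simp: h_def eventually_at_filter)
  ultimately show ?thesis
    using meromorphic_on_cong[of "{0}" "\<lambda>v. h v / v ^ Suc N" f "{0}"] by blast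
qed

section \<open>Charts and maps to the Riemann sphere\<close>

text \<open>The coordinate of the sphere at infinity. Outside its chart, at \<open>Some 0\<close>,
  it also takes the value \<open>inverse 0 = 0\<close>; therefore a zero identifies
  \<open>None\<close> only where \<open>Some 0\<close> is excluded.\<close>

definition inv_coord :: "complex option \<Rightarrow> complex" where
  "inv_coord x = (case x of None \<Rightarrow> 0 | Some z \<Rightarrow> inverse z)"

lemma inv_coord_simps [simp]: "inv_coord None = 0" "inv_coord (Some z) = inverse z"
  by (simp_all add: inv_coord_def)

lemma inv_coord_eq_0_iff: "v \<noteq> Some 0 \<Longrightarrow> inv_coord v = 0 \<longleftrightarrow> v = None"
  by (auto simp: inv_coord_def split: option.splits)

lemma inv_coord_eqD: "inv_coord y = v \<Longrightarrow> v \<noteq> 0 \<Longrightarrow> y = Some (inverse v)"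
  by (auto simp: inv_coord_def split: option.splits)

lemma riemann_sphere_atlas_eq:
  "riemann_sphere_atlas = {(range Some, the), (UNIV - {Some 0}, inv_coord)}"
  by (simp add: riemann_sphere_atlas_def inv_coord_def[abs_def])

lemma topspace_riemann_sphere [simp]: "topspace riemann_sphere = UNIV"
  by (auto simp: riemann_sphere_def UNIV_option_conv)

lemma openin_riemann_sphere_finite_points [simp]: "openin riemann_sphere (range Some)"
  by (auto simp: riemann_sphere_def openin_Alexandroff_compactification)

lemma openin_riemann_sphere_ball: "openin riemann_sphere (Some ` ball 0 R)"
  by (auto simp: riemann_sphere_def openin_Alexandroff_compactification)

lemma openin_riemann_sphere_nonzero [simp]: "openin riemann_sphere (UNIV - {Some 0})"
proof -
  have "UNIV - {Some 0} = insert None (Some ` (UNIV - {0 :: complex}))"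
    by (auto simp: notin_range_Some image_iff)
  moreover have "compactin euclidean {0 :: complex}" "closedin euclidean {0 :: complex}" by simp_all
  ultimately show ?thesis
    unfolding riemann_sphere_def openin_Alexandroff_compactification topspace_euclidean by blast
qed

lemma openin_riemann_sphere_atlas:
  "(V, \<psi>) \<in> riemann_sphere_atlas \<Longrightarrow> openin riemann_sphere V"
  by (auto simp: riemann_sphere_atlas_eq)

lemma inj_on_riemann_sphere_atlas:
  "(V, \<psi>) \<in> riemann_sphere_atlas \<Longrightarrow> inj_on \<psi> V"
  by (auto simp: riemann_sphere_atlas_eq inj_on_def inv_coord_def split: option.splits)

lemma eventually_openin_riemann_sphere:
  assumes "openin riemann_sphere V" "None \<in> V"
  shows "\<forall>\<^sub>F z in at_infinity. Some z \<in> V"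
proof -
  obtain C :: "complex set" where C: "compact C" "V = insert None (Some ` (UNIV - C))"
    using assms by (auto simp: riemann_sphere_def openin_Alexandroff_compactification compactin_euclidean_iff)
  obtain B where "\<And>z. z \<in> C \<Longrightarrow> norm z \<le> B"
    using compact_imp_bounded[OF C(1)] by (auto simp: bounded_iff)
  then show ?thesis
    unfolding eventually_at_infinity using C(2)
    by (intro exI[of _ "B + 1"]) (force simp: image_iff)
qed

section \<open>Charts and functions in local coordinates\<close>

lemma is_chart_inj: "is_chart X (U, \<phi>) \<Longrightarrow> inj_on \<phi> U"
  by (auto simp: is_chart_def homeomorphic_eq_everything_map dest!: openin_subset)
     (metis Int_absorb1 inf.commute)

lemma is_chart_open_image:
  assumes "is_chart X (U, \<phi>)" "openin X W" "W \<subseteq> U"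
  shows "open (\<phi> ` W)"
proof -
  have "open_map (subtopology X U) (top_of_set (\<phi> ` U)) \<phi>" "open (\<phi> ` U)"
    using assms by (auto simp: is_chart_def homeomorphic_eq_everything_map)
  moreover have "openin (subtopology X U) W"
    using assms by (auto simp: openin_subtopology)
  ultimately show ?thesis
    by (auto simp: open_map_def intro: openin_open_trans)
qed

lemma is_chart_open_vimage:
  assumes "is_chart X (U, \<phi>)" "open S"
  shows "openin X (U \<inter> \<phi> -` S)"
proof -
  have c: "continuous_map (subtopology X U) (top_of_set (\<phi> ` U)) \<phi>" and U: "openin X U"
    using assms by (auto simp: is_chart_def homeomorphic_eq_everything_map)
  have "openin (top_of_set (\<phi> ` U)) (\<phi> ` U \<inter> S)"
    using assms by auto
  then have "openin (subtopology X U) {x \<in> topspace (subtopology X U). \<phi> x \<in> \<phi> ` U \<inter> S}"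
    using c by (rule openin_continuous_map_preimage[rotated])
  moreover have "{x \<in> topspace (subtopology X U). \<phi> x \<in> \<phi> ` U \<inter> S} = U \<inter> \<phi> -` S"
    using openin_subset[OF U] by auto
  ultimately show ?thesis using U by (simp add: openin_open_subtopology)
qed

text \<open>A chart matches punctured neighbourhoods of \<open>q\<close> and of
  \<open>\<phi> q\<close>; statements near a point of the surface thus become statements about
  functions of one complex variable.\<close>

lemma eventually_atin_chart:
  assumes c: "is_chart X (U, \<phi>)" and q: "q \<in> U"
  shows "eventually P (atin X q) \<longleftrightarrow> (\<forall>\<^sub>F \<zeta> in at (\<phi> q). P (inv_into U \<phi> \<zeta>))"
proof -
  have U: "openin X U" and oU: "open (\<phi> ` U)" using c by (auto simp: is_chart_def)
  have qX: "q \<in> topspace X" using U q openin_subset by blast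
  note inj = is_chart_inj[OF c]
  show ?thesis
  proof
    assume "eventually P (atin X q)"
    then obtain W where W: "openin X W" "q \<in> W" "\<forall>x\<in>W - {q}. P x"
      using qX by (auto simp: eventually_atin)
    have "open (\<phi> ` (W \<inter> U))" using W U by (intro is_chart_open_image[OF c]) auto
    moreover have "\<phi> q \<in> \<phi> ` (W \<inter> U)" using W q by auto
    moreover have "P (inv_into U \<phi> \<zeta>)" if "\<zeta> \<in> \<phi> ` (W \<inter> U)" "\<zeta> \<noteq> \<phi> q" for \<zeta>
      using that W inj by (auto simp: inv_into_f_f)
    ultimately show "\<forall>\<^sub>F \<zeta> in at (\<phi> q). P (inv_into U \<phi> \<zeta>)"
      unfolding eventually_at_topological by blast
  next
    assume "\<forall>\<^sub>F \<zeta> in at (\<phi> q). P (inv_into U \<phi> \<zeta>)"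
    then obtain S where S: "open S" "\<phi> q \<in> S" "\<And>\<zeta>. \<zeta> \<in> S \<Longrightarrow> \<zeta> \<noteq> \<phi> q \<Longrightarrow> P (inv_into U \<phi> \<zeta>)"
      unfolding eventually_at_topological by blast
    have "P x" if "x \<in> U \<inter> \<phi> -` S - {q}" for x
      using S(3)[of "\<phi> x"] that q inj by (auto simp: inv_into_f_f inj_on_eq_iff)
    then show "eventually P (atin X q)"
      unfolding eventually_atin using is_chart_open_vimage[OF c S(1)] S(2) q by blast
  qed
qed

lemma chart_at_riemann_sphere:
  "chart_at riemann_sphere_atlas y \<in> riemann_sphere_atlas \<and> y \<in> fst (chart_at riemann_sphere_atlas y)"
  unfolding chart_at_def
  by (rule someI_ex) (cases y, auto simp: riemann_sphere_atlas_eq)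

lemma holomorphic_map_to_sphere_chart:
  assumes f: "holomorphic_map X \<A> riemann_sphere riemann_sphere_atlas f"
    and c: "(U, \<phi>) \<in> \<A>" "is_chart X (U, \<phi>)" and V: "(V, \<psi>) \<in> riemann_sphere_atlas"
  shows "open (\<phi> ` (U \<inter> f -` V))"
    and "(\<lambda>\<zeta>. \<psi> (f (inv_into U \<phi> \<zeta>))) holomorphic_on \<phi> ` (U \<inter> f -` V)"
proof -
  have U: "openin X U" using c by (auto simp: is_chart_def)
  have "openin X {x \<in> topspace X. f x \<in> V}"
    using f openin_riemann_sphere_atlas[OF V]
    by (auto simp: holomorphic_map_def intro: openin_continuous_map_preimage)
  then have "openin X (U \<inter> {x \<in> topspace X. f x \<in> V})" using U by (rule openin_Int[rotated])
  also have "U \<inter> {x \<in> topspace X. f x \<in> V} = U \<inter> f -` V"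
    using openin_subset[OF U] by auto
  finally show "open (\<phi> ` (U \<inter> f -` V))" by (intro is_chart_open_image[OF c(2)]) auto
  show "(\<lambda>\<zeta>. \<psi> (f (inv_into U \<phi> \<zeta>))) holomorphic_on \<phi> ` (U \<inter> f -` V)"
    using f c V by (fastforce simp: holomorphic_map_def comp_def)
qed

lemma analytic_in_chart:
  assumes f: "holomorphic_map X \<A> riemann_sphere riemann_sphere_atlas f"
    and c: "(U, \<phi>) \<in> \<A>" "is_chart X (U, \<phi>)" and V: "(V, \<psi>) \<in> riemann_sphere_atlas"
    and x: "x \<in> U" "f x \<in> V"
  shows "(\<lambda>\<zeta>. \<psi> (f (inv_into U \<phi> \<zeta>))) analytic_on {\<phi> x}"
    and "\<forall>\<^sub>F \<zeta> in at (\<phi> x). f (inv_into U \<phi> \<zeta>) \<in> V"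
proof -
  note h = holomorphic_map_to_sphere_chart[OF f c V]
  have mem: "\<phi> x \<in> \<phi> ` (U \<inter> f -` V)" using x by auto
  show "(\<lambda>\<zeta>. \<psi> (f (inv_into U \<phi> \<zeta>))) analytic_on {\<phi> x}"
    using h mem analytic_at by blast
  show "\<forall>\<^sub>F \<zeta> in at (\<phi> x). f (inv_into U \<phi> \<zeta>) \<in> V"
    using eventually_at_in_open'[OF h(1) mem]
    by eventually_elim (use is_chart_inj[OF c(2)] in \<open>auto simp: inv_into_f_f\<close>)
qed

text \<open>At a finite value the affine coordinate is analytic. At the value \<open>None\<close> it
  is the reciprocal of the analytic coordinate at infinity, unless the function is
  \<open>None\<close> throughout a neighbourhood and \<open>the\<close> yields a constant.\<close>

lemma meromorphic_in_chart:
  assumes f: "holomorphic_map X \<A> riemann_sphere riemann_sphere_atlas f"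
    and c: "(U, \<phi>) \<in> \<A>" "is_chart X (U, \<phi>)" and x: "x \<in> U"
  shows "(\<lambda>\<zeta>. the (f (inv_into U \<phi> \<zeta>))) meromorphic_on {\<phi> x}"
proof (cases "f x")
  case (Some y)
  then show ?thesis
    using analytic_in_chart[OF f c, of "range Some" the x] x
    by (auto simp: riemann_sphere_atlas_eq intro: analytic_on_imp_meromorphic_on)
next
  case None
  let ?h = "\<lambda>\<zeta>. inv_coord (f (inv_into U \<phi> \<zeta>))"
  have a: "?h analytic_on {\<phi> x}" and e: "\<forall>\<^sub>F \<zeta> in at (\<phi> x). f (inv_into U \<phi> \<zeta>) \<in> UNIV - {Some 0}"
    using analytic_in_chart[OF f c, of "UNIV - {Some 0}" inv_coord x] x None
    by (auto simp: riemann_sphere_atlas_eq)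
  have eq: "v \<noteq> None \<Longrightarrow> the v = inverse (inv_coord v)" "v \<noteq> Some 0 \<Longrightarrow> inv_coord v = 0 \<longleftrightarrow> v = None" for v
    by (auto simp: inv_coord_def split: option.splits)
  from analytic_at_eventually_zero_or_nonzero[OF a] show ?thesis
  proof
    assume "\<forall>\<^sub>F \<zeta> in at (\<phi> x). ?h \<zeta> = 0"
    with e have "\<forall>\<^sub>F \<zeta> in at (\<phi> x). the (f (inv_into U \<phi> \<zeta>)) = the None"
      by eventually_elim (simp add: eq(2))
    then show ?thesis
      by (subst meromorphic_on_cong[where g = "\<lambda>_. the None"]) auto
  next
    assume "\<forall>\<^sub>F \<zeta> in at (\<phi> x). ?h \<zeta> \<noteq> 0"
    with e have "\<forall>\<^sub>F \<zeta> in at (\<phi> x). the (f (inv_into U \<phi> \<zeta>)) = inverse (?h \<zeta>)"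
      by eventually_elim (metis eq(1) inv_coord_simps(1))
    moreover have "(\<lambda>\<zeta>. inverse (?h \<zeta>)) meromorphic_on {\<phi> x}"
      using a by (intro meromorphic_intros analytic_on_imp_meromorphic_on)
    ultimately show ?thesis
      by (subst meromorphic_on_cong[where g = "\<lambda>\<zeta>. inverse (?h \<zeta>)"]) auto
  qed
qed

section \<open>Multiplicity one and local injectivity\<close>

lemma riemann_surface_chartE:
  assumes "riemann_surface X \<A>" "x \<in> topspace X"
  obtains U \<phi> where "chart_at \<A> x = (U, \<phi>)" "(U, \<phi>) \<in> \<A>" "is_chart X (U, \<phi>)" "x \<in> U"
proof -
  have "x \<in> (\<Union>c\<in>\<A>. fst c)" using assms by (simp add: riemann_surface_def)
  then have "\<exists>c. c \<in> \<A> \<and> x \<in> fst c" by blast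
  then have "chart_at \<A> x \<in> \<A> \<and> x \<in> fst (chart_at \<A> x)"
    unfolding chart_at_def by (rule someI_ex)
  moreover have "is_chart X (chart_at \<A> x)" using calculation assms by (auto simp: riemann_surface_def)
  ultimately show ?thesis using that by (cases "chart_at \<A> x") auto
qed

text \<open>The multiplicity refers to one particular pair of charts, local injectivity to none.\<close>

lemma multiplicity_eq_1_if_locally_injective:
  assumes X: "riemann_surface X \<A>" and f: "holomorphic_map X \<A> riemann_sphere riemann_sphere_atlas f"
    and W: "openin X W" "x \<in> W" "inj_on f W"
  shows "multiplicity_at \<A> riemann_sphere_atlas f x = 1"
proof -
  have "x \<in> topspace X" using W openin_subset by blast
  then obtain U \<phi> where U: "chart_at \<A> x = (U, \<phi>)" "(U, \<phi>) \<in> \<A>" "is_chart X (U, \<phi>)" "x \<in> U"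
    using riemann_surface_chartE[OF X] by metis
  obtain V \<psi> where V: "chart_at riemann_sphere_atlas (f x) = (V, \<psi>)" "(V, \<psi>) \<in> riemann_sphere_atlas" "f x \<in> V"
    using chart_at_riemann_sphere[of "f x"] by (metis fst_conv surj_pair)
  define G where "G = (\<lambda>\<zeta>. \<psi> (f (inv_into U \<phi> \<zeta>)) - \<psi> (f x))"
  define D where "D = \<phi> ` (U \<inter> f -` V) \<inter> \<phi> ` (W \<inter> U)"
  note h = holomorphic_map_to_sphere_chart[OF f U(2,3) V(2)]
  have D: "open D" "\<phi> x \<in> D" "G holomorphic_on D"
    unfolding D_def G_def using h U W V
    by (auto intro!: is_chart_open_image[OF U(3)] openin_Int holomorphic_intros
        intro: holomorphic_on_subset simp: is_chart_def)
  have G0: "G (\<phi> x) = 0" using U is_chart_inj[OF U(3)] by (simp add: G_def inv_into_f_f)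
  have "inj_on G D"
  proof (rule inj_onI)
    fix a b assume ab: "a \<in> D" "b \<in> D" "G a = G b"
    then obtain y z where y: "y \<in> U" "y \<in> W" "f y \<in> V" "a = \<phi> y" and z: "z \<in> U" "z \<in> W" "f z \<in> V" "b = \<phi> z"
      using is_chart_inj[OF U(3)] unfolding D_def inj_on_def by blast
    with ab(3) have "\<psi> (f y) = \<psi> (f z)"
      using is_chart_inj[OF U(3)] by (simp add: G_def inv_into_f_f)
    then have "f y = f z" using inj_on_riemann_sphere_atlas[OF V(2)] y z by (auto dest: inj_onD)
    then show "a = b" using W(3) y z by (auto dest: inj_onD)
  qed
  then have "deriv G (\<phi> x) \<noteq> 0" using holomorphic_injective_imp_regular D by blast
  then have "zorder G (\<phi> x) = 1"
    using G0 D by (intro zorder_zero_eqI[of G D]) (auto simp: less_Suc_eq)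
  then show ?thesis by (simp add: multiplicity_at_def U(1) V(1) G_def)
qed

text \<open>As \<open>f\<close> is not locally constant at \<open>x\<close>, the order of
  \<open>G\<close> is positive; a multiplicity of at most \<open>1\<close> then means a simple zero,
  hence a nonzero derivative and local injectivity.\<close>

lemma locally_injective_if_multiplicity_le_1:
  assumes X: "riemann_surface X \<A>" and f: "holomorphic_map X \<A> riemann_sphere riemann_sphere_atlas f"
    and x: "x \<in> topspace X" and nc: "\<forall>\<^sub>F y in atin X x. f y \<noteq> f x"
    and mult: "multiplicity_at \<A> riemann_sphere_atlas f x \<le> 1"
  obtains W where "openin X W" "x \<in> W" "inj_on f W"
proof -
  obtain U \<phi> where U: "chart_at \<A> x = (U, \<phi>)" "(U, \<phi>) \<in> \<A>" "is_chart X (U, \<phi>)" "x \<in> U"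
    using riemann_surface_chartE[OF X x] by metis
  note inj = is_chart_inj[OF U(3)]
  obtain V \<psi> where V: "chart_at riemann_sphere_atlas (f x) = (V, \<psi>)" "(V, \<psi>) \<in> riemann_sphere_atlas" "f x \<in> V"
    using chart_at_riemann_sphere[of "f x"] by (metis fst_conv surj_pair)
  define G where "G = (\<lambda>\<zeta>. \<psi> (f (inv_into U \<phi> \<zeta>)) - \<psi> (f x))"
  define D where "D = \<phi> ` (U \<inter> f -` V)"
  note h = holomorphic_map_to_sphere_chart[OF f U(2,3) V(2)]
  have D: "open D" "\<phi> x \<in> D" "G holomorphic_on D"
    unfolding D_def G_def using h U V by (auto intro!: holomorphic_intros)
  have G0: "G (\<phi> x) = 0" using U inj by (simp add: G_def inv_into_f_f)
  have "\<forall>\<^sub>F \<zeta> in at (\<phi> x). f (inv_into U \<phi> \<zeta>) \<noteq> f x"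
    using nc by (simp add: eventually_atin_chart[OF U(3,4)])
  with analytic_in_chart(2)[OF f U(2,3) V(2) U(4) V(3)]
  have "\<forall>\<^sub>F \<zeta> in at (\<phi> x). G \<zeta> \<noteq> 0"
    by eventually_elim (use inj_on_riemann_sphere_atlas[OF V(2)] V(3) in \<open>auto simp: G_def dest: inj_onD\<close>)
  then have freq: "\<exists>\<^sub>F \<zeta> in at (\<phi> x). G \<zeta> \<noteq> 0" by (simp add: eventually_frequently)
  have "zorder G (\<phi> x) > 0" using zorder_pos_iff[OF D(3,1,2) freq] G0 by simp
  moreover have "nat (zorder G (\<phi> x)) \<le> 1"
    using mult by (simp add: multiplicity_at_def U(1) V(1) G_def)
  ultimately have z1: "zorder G (\<phi> x) = 1" by linarith
  have "deriv G (\<phi> x) \<noteq> 0"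
  proof -
    have "isolated_singularity_at G (\<phi> x)" "not_essential G (\<phi> x)"
      using D analytic_at isolated_singularity_at_analytic not_essential_analytic by blast+
    from zorder_exist[OF this freq]
    obtain r where r: "zor_poly G (\<phi> x) (\<phi> x) \<noteq> 0" "r > 0" "zor_poly G (\<phi> x) holomorphic_on cball (\<phi> x) r"
      "\<And>w. w \<in> cball (\<phi> x) r - {\<phi> x} \<Longrightarrow> G w = zor_poly G (\<phi> x) w * (w - \<phi> x)"
      by (auto simp: z1)
    have "isCont (zor_poly G (\<phi> x)) (\<phi> x)"
      using holomorphic_on_imp_continuous_on[OF r(3)] r(2)
        continuous_on_interior[of "cball (\<phi> x) r" "zor_poly G (\<phi> x)" "\<phi> x"]
      by simp
    then have lim: "zor_poly G (\<phi> x) \<midarrow>\<phi> x\<rightarrow> zor_poly G (\<phi> x) (\<phi> x)" by (simp add: isCont_def)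
    have "\<forall>\<^sub>F w in at (\<phi> x). w \<in> cball (\<phi> x) r - {\<phi> x}"
      using r(2) by (auto simp: eventually_at dist_commute intro!: exI[of _ r])
    \<comment> \<open>At its simple zero the difference quotient of \<open>G\<close> is the
      nonvanishing factor \<open>zor_poly\<close>, whose value at \<open>\<phi> x\<close> is
      therefore the derivative.\<close>
    then have "\<forall>\<^sub>F w in at (\<phi> x). zor_poly G (\<phi> x) w = (G w - G (\<phi> x)) / (w - \<phi> x)"
      by eventually_elim (use r(4) G0 in simp)
    with lim have "(\<lambda>w. (G w - G (\<phi> x)) / (w - \<phi> x)) \<midarrow>\<phi> x\<rightarrow> zor_poly G (\<phi> x) (\<phi> x)"
      by (rule Lim_transform_eventually)
    then have "(G has_field_derivative zor_poly G (\<phi> x) (\<phi> x)) (at (\<phi> x))"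
      by (simp add: has_field_derivative_iff)
    with r(1) show ?thesis by (simp add: DERIV_imp_deriv)
  qed
  then obtain r where r: "r > 0" "ball (\<phi> x) r \<subseteq> D" "inj_on G (ball (\<phi> x) r)"
    using has_complex_derivative_locally_injective[OF D(3,2,1)] by metis
  show ?thesis
  proof
    show "openin X (U \<inter> \<phi> -` ball (\<phi> x) r)" by (rule is_chart_open_vimage[OF U(3)]) simp
    show "x \<in> U \<inter> \<phi> -` ball (\<phi> x) r" using r U by simp
    show "inj_on f (U \<inter> \<phi> -` ball (\<phi> x) r)"
    proof (rule inj_onI)
      fix y z assume yz: "y \<in> U \<inter> \<phi> -` ball (\<phi> x) r" "z \<in> U \<inter> \<phi> -` ball (\<phi> x) r" "f y = f z"
      then have "G (\<phi> y) = G (\<phi> z)" using inj by (simp add: G_def inv_into_f_f)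
      then have "\<phi> y = \<phi> z" using r yz by (auto dest: inj_onD)
      then show "y = z" using inj yz by (auto dest: inj_onD)
    qed
  qed
qed

section \<open>The covering near infinity\<close>

locale sphere_covering =
  fixes X :: "'a topology" and \<A> :: "'a chart set" and m :: nat and \<pi> :: "'a \<Rightarrow> complex option"
  assumes surface: "riemann_surface X \<A>" and compact: "compact_space X"
    and connected: "connected_space X" and covering: "branched_covering X \<A> (m + 1) \<pi>"
begin

lemma holomorphic: "holomorphic_map X \<A> riemann_sphere riemann_sphere_atlas \<pi>"
  using covering by (simp add: branched_covering_def)

lemma openin_vimage: "openin riemann_sphere V \<Longrightarrow> openin X {x \<in> topspace X. \<pi> x \<in> V}"
  using holomorphic by (auto simp: holomorphic_map_def intro: openin_continuous_map_preimage)

lemma chartE: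
  assumes "x \<in> topspace X"
  obtains U \<phi> where "(U, \<phi>) \<in> \<A>" "is_chart X (U, \<phi>)" "x \<in> U"
  using riemann_surface_chartE[OF surface assms] by metis

lemma inv_coord_in_chart:
  assumes c: "(U, \<phi>) \<in> \<A>" "is_chart X (U, \<phi>)" "q \<in> U" and q: "\<pi> q = None"
  shows "(\<lambda>\<zeta>. inv_coord (\<pi> (inv_into U \<phi> \<zeta>))) analytic_on {\<phi> q}"
    and "\<forall>\<^sub>F \<zeta> in at (\<phi> q). \<pi> (inv_into U \<phi> \<zeta>) \<noteq> Some 0"
  using analytic_in_chart[OF holomorphic c(1,2), of "UNIV - {Some 0}" inv_coord q] c q
  by (auto simp: riemann_sphere_atlas_eq)

text \<open>The points near which \<open>\<pi>\<close> is constantly \<open>None\<close> form an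
  open and closed set \<open>S\<close>. On a connected surface it is empty or everything, and the
  fibre condition rules out the latter.\<close>

lemma eventually_finite:
  assumes "q \<in> fiber X \<pi> None"
  shows "\<forall>\<^sub>F x in atin X q. \<pi> x \<noteq> None"
proof -
  \<comment> \<open>The coordinate at infinity is analytic in a chart, so its zeros are isolated or
    fill a neighbourhood.\<close>
  have dich: "(\<forall>\<^sub>F y in atin X x. \<pi> y = None) \<or> (\<forall>\<^sub>F y in atin X x. \<pi> y \<noteq> None)"
    if x: "x \<in> fiber X \<pi> None" for x
  proof -
    have "x \<in> topspace X" using x by (simp add: fiber_def)
    then obtain U \<phi> where c: "(U, \<phi>) \<in> \<A>" "is_chart X (U, \<phi>)" "x \<in> U"
      by (rule chartE)
    have x': "\<pi> x = None" using x by (simp add: fiber_def)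
    note ic = inv_coord_in_chart[OF c x']
    from analytic_at_eventually_zero_or_nonzero[OF ic(1)] show ?thesis
    proof (elim disjE)
      assume "\<forall>\<^sub>F \<zeta> in at (\<phi> x). inv_coord (\<pi> (inv_into U \<phi> \<zeta>)) = 0"
      with ic(2) show ?thesis
        unfolding eventually_atin_chart[OF c(2,3)]
        by (intro disjI1, eventually_elim) (simp add: inv_coord_eq_0_iff)
    next
      assume "\<forall>\<^sub>F \<zeta> in at (\<phi> x). inv_coord (\<pi> (inv_into U \<phi> \<zeta>)) \<noteq> 0"
      then show ?thesis
        unfolding eventually_atin_chart[OF c(2,3)]
        by (intro disjI2, eventually_elim) (metis inv_coord_simps(1))
    qed
  qed
  define S where "S = {x \<in> fiber X \<pi> None. \<forall>\<^sub>F y in atin X x. \<pi> y = None}"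
  have SX: "S \<subseteq> topspace X" by (auto simp: S_def fiber_def)
  have "openin X S"
  proof (subst openin_subopen, safe)
    fix x assume x: "x \<in> S"
    then obtain U where U: "openin X U" "x \<in> U" "\<forall>y\<in>U - {x}. \<pi> y = None"
      using SX by (auto simp: S_def eventually_atin)
    have none: "\<pi> y = None" if "y \<in> U" for y
      using U(3) x that by (cases "y = x") (auto simp: S_def fiber_def)
    have "U \<subseteq> S"
    proof
      fix y assume "y \<in> U"
      then show "y \<in> S" using openin_subset[OF U(1)] none U(1)
        by (auto simp: S_def fiber_def eventually_atin)
    qed
    with U show "\<exists>T. openin X T \<and> x \<in> T \<and> T \<subseteq> S" by blast
  qed
  moreover have "openin X (topspace X - S)"
  proof (subst openin_subopen, intro ballI)
    fix x assume x: "x \<in> topspace X - S"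
    show "\<exists>T. openin X T \<and> x \<in> T \<and> T \<subseteq> topspace X - S"
    proof (cases "\<pi> x = None")
      case False
      have "openin X {x \<in> topspace X. \<pi> x \<in> range Some}" by (rule openin_vimage) simp
      moreover have "x \<in> {x \<in> topspace X. \<pi> x \<in> range Some}" using x False by auto
      moreover have "{x \<in> topspace X. \<pi> x \<in> range Some} \<subseteq> topspace X - S"
        by (auto simp: S_def fiber_def)
      ultimately show ?thesis by blast
    next
      case True
      with x dich[of x] have "\<forall>\<^sub>F y in atin X x. \<pi> y \<noteq> None" by (auto simp: S_def fiber_def)
      then obtain U where U: "openin X U" "x \<in> U" "\<forall>y\<in>U - {x}. \<pi> y \<noteq> None"
        using x by (auto simp: eventually_atin)
      have "U \<subseteq> topspace X - S"
      proof
        fix y assume y: "y \<in> U"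
        have "y \<notin> S" using x U(3) y by (cases "y = x") (auto simp: S_def fiber_def)
        then show "y \<in> topspace X - S" using openin_subset[OF U(1)] y by auto
      qed
      with U show ?thesis by blast
    qed
  qed
  ultimately have "S = {} \<or> S = topspace X"
    using connected SX by (auto simp: connected_space_clopen_in closedin_def)
  \<comment> \<open>If \<open>\<pi>\<close> were constantly \<open>None\<close>, then
    \<open>Some 0\<close> would not be a critical value and would have \<open>m + 1 > 0\<close>
    preimages.\<close>
  moreover have "S \<noteq> topspace X" if "S \<noteq> {}"
  proof
    assume "S = topspace X"
    then have none: "\<pi> x = None" if "x \<in> topspace X" for x using that by (auto simp: S_def fiber_def)
    then have "Some 0 \<notin> critical_values X \<A> \<pi>" by (auto simp: critical_values_def critical_points_def)
    then have "card (fiber X \<pi> (Some 0)) = m + 1" using covering by (simp add: branched_covering_def)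
    moreover have "fiber X \<pi> (Some 0) = {}" using none by (auto simp: fiber_def)
    ultimately show False by simp
  qed
  ultimately show ?thesis using assms dich[OF assms] by (auto simp: S_def)
qed

text \<open>Compactness turns statements near the points over infinity into statements about all points
  over the complement of a large disc.\<close>

lemma eventually_fiber_at_infinity:
  fixes \<Phi> :: "nat \<Rightarrow> 'a \<Rightarrow> bool"
  assumes mono: "\<And>C D x. \<Phi> C x \<Longrightarrow> C \<le> D \<Longrightarrow> \<Phi> D x"
    and ev: "\<And>q. q \<in> fiber X \<pi> None \<Longrightarrow> \<exists>C. \<forall>\<^sub>F x in atin X q. \<Phi> C x"
  shows "\<exists>C. \<forall>\<^sub>F z in at_infinity. \<forall>x\<in>fiber X \<pi> (Some z). \<Phi> C x"
proof -
  \<comment> \<open>Points over infinity and over the disc of radius \<open>C\<close> count as good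
    as well. The interiors \<open>G C\<close> of the good sets then increase with \<open>C\<close>
    and cover the surface, and compactness leaves a single \<open>C\<close>.\<close>
  define good where "good C x \<longleftrightarrow> \<pi> x = None \<or> cmod (the (\<pi> x)) < real C \<or> \<Phi> C x" for C x
  have good_mono: "good C x \<Longrightarrow> C \<le> D \<Longrightarrow> good D x" for C D x
    using mono of_nat_mono[of C D] unfolding good_def by (metis less_le_trans)
  define G where "G C = \<Union>{W. openin X W \<and> (\<forall>x\<in>W. good C x)}" for C
  have G_open: "openin X (G C)" for C by (auto simp: G_def)
  have G_mono: "G C \<subseteq> G D" if "C \<le> D" for C D
    unfolding G_def using good_mono[OF _ that] by blast
  have "topspace X \<subseteq> \<Union>(range G)"
  proof
    fix x assume x: "x \<in> topspace X"
    show "x \<in> \<Union>(range G)"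
    proof (cases "\<pi> x")
      case None
      then obtain C where "\<forall>\<^sub>F x in atin X x. \<Phi> C x" using ev x by (auto simp: fiber_def)
      then obtain W where "openin X W" "x \<in> W" "\<forall>y\<in>W - {x}. \<Phi> C y"
        using x by (auto simp: eventually_atin)
      then have "x \<in> G C" using None by (auto simp: G_def good_def)
      then show ?thesis by blast
    next
      case (Some z)
      obtain C where C: "cmod z < real C" using reals_Archimedean2 by blast
      have "openin X {y \<in> topspace X. \<pi> y \<in> Some ` ball 0 (real C)}"
        by (intro openin_vimage openin_riemann_sphere_ball)
      moreover have "x \<in> {y \<in> topspace X. \<pi> y \<in> Some ` ball 0 (real C)}"
        using x Some C by auto
      moreover have "\<forall>y\<in>{y \<in> topspace X. \<pi> y \<in> Some ` ball 0 (real C)}. good C y"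
        by (auto simp: good_def)
      ultimately have "x \<in> G C" unfolding G_def by blast
      then show ?thesis by blast
    qed
  qed
  then obtain \<F> where \<F>: "finite \<F>" "\<F> \<subseteq> range G" "topspace X \<subseteq> \<Union>\<F>"
    using compact G_open unfolding compact_space_def compactin_def by (metis (no_types, lifting) rangeE)
  then obtain N where N: "finite N" "\<F> = G ` N" by (metis finite_subset_image)
  define C where "C = Max (insert 0 N)"
  have "topspace X \<subseteq> G C"
  proof
    fix x assume "x \<in> topspace X"
    then obtain n where "n \<in> N" "x \<in> G n" using \<F> N by blast
    moreover have "n \<le> C" using N \<open>n \<in> N\<close> by (simp add: C_def)
    ultimately show "x \<in> G C" using G_mono by blast
  qed
  then have good: "good C x" if "x \<in> topspace X" for x using that by (auto simp: G_def)
  have "\<forall>\<^sub>F z in at_infinity. \<forall>x\<in>fiber X \<pi> (Some z). \<Phi> C x"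
    unfolding eventually_at_infinity
  proof (intro exI[of _ "real C"] allI impI ballI)
    fix z x assume "real C \<le> cmod z" "x \<in> fiber X \<pi> (Some z)"
    then show "\<Phi> C x" using good[of x] by (auto simp: good_def fiber_def)
  qed
  then show ?thesis by blast
qed

section \<open>Polynomial growth over infinity\<close>

text \<open>Turns the pole order in a local coordinate \<open>\<zeta>\<close> into growth in
  \<open>z\<close>. As \<open>1 / z\<close> is differentiable and vanishes at \<open>q\<close>, its
  square is bounded by the distance from \<open>\<zeta>\<close> to \<open>\<phi> q\<close>, even if
  \<open>\<pi>\<close> is ramified at \<open>q\<close>; this doubles the exponent.\<close>

lemma growth_near_infinity:
  assumes q: "q \<in> fiber X \<pi> None"
    and g: "holomorphic_map X \<A> riemann_sphere riemann_sphere_atlas g"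
  shows "\<exists>N::nat. \<forall>\<^sub>F x in atin X q. 1 \<le> cmod (the (\<pi> x)) \<and> cmod (the (g x)) \<le> cmod (the (\<pi> x)) ^ N"
proof -
  have "q \<in> topspace X" and q': "\<pi> q = None" using q by (auto simp: fiber_def)
  then obtain U \<phi> where c: "(U, \<phi>) \<in> \<A>" "is_chart X (U, \<phi>)" "q \<in> U" by (metis chartE)
  define G where "G = (\<lambda>\<zeta>. inv_coord (\<pi> (inv_into U \<phi> \<zeta>)))"
  note ic = inv_coord_in_chart[OF c q', folded G_def]
  have G0: "G (\<phi> q) = 0" using q' c is_chart_inj[OF c(2)] by (simp add: G_def)
  obtain N where N: "\<forall>\<^sub>F \<zeta> in at (\<phi> q). cmod (the (g (inv_into U \<phi> \<zeta>))) * cmod (\<zeta> - \<phi> q) ^ N \<le> 1"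
    using meromorphic_at_upper_bound[OF meromorphic_in_chart[OF g c]] by blast
  have "(G has_field_derivative deriv G (\<phi> q)) (at (\<phi> q))"
    using ic(1) analytic_on_imp_differentiable_at DERIV_deriv_iff_field_differentiable by blast
  then have quot: "((\<lambda>\<zeta>. G \<zeta> / (\<zeta> - \<phi> q)) \<longlongrightarrow> deriv G (\<phi> q)) (at (\<phi> q))"
    by (simp add: has_field_derivative_iff G0)
  have lim: "(G \<longlongrightarrow> 0) (at (\<phi> q))"
    using analytic_at_imp_isCont[OF ic(1)] G0 by (simp add: isCont_def)
  \<comment> \<open>With the second factor \<open>G\<close> the limit is \<open>0\<close> whatever
    the derivative is, so the estimate holds with constant \<open>1\<close>.\<close>
  have "((\<lambda>\<zeta>. G \<zeta> * (G \<zeta> / (\<zeta> - \<phi> q))) \<longlongrightarrow> 0 * deriv G (\<phi> q)) (at (\<phi> q))"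
    by (intro tendsto_mult lim quot)
  then have "\<forall>\<^sub>F \<zeta> in at (\<phi> q). cmod (G \<zeta> * (G \<zeta> / (\<zeta> - \<phi> q))) < 1"
    by (simp add: tendsto_iff dist_norm)
  moreover have "\<forall>\<^sub>F \<zeta> in at (\<phi> q). cmod (G \<zeta>) < 1"
    using lim by (simp add: tendsto_iff dist_norm)
  moreover have "\<forall>\<^sub>F \<zeta> in at (\<phi> q). \<pi> (inv_into U \<phi> \<zeta>) \<noteq> None"
    using eventually_finite[OF q] by (simp add: eventually_atin_chart[OF c(2,3)])
  moreover have "\<forall>\<^sub>F \<zeta> in at (\<phi> q). \<zeta> \<noteq> \<phi> q" by (simp add: eventually_at_filter)
  ultimately have "\<forall>\<^sub>F \<zeta> in at (\<phi> q). 1 \<le> cmod (the (\<pi> (inv_into U \<phi> \<zeta>))) \<and>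
      cmod (the (g (inv_into U \<phi> \<zeta>))) \<le> cmod (the (\<pi> (inv_into U \<phi> \<zeta>))) ^ (2 * N)"
    using N ic(2)
  proof eventually_elim
    case (elim \<zeta>)
    then obtain z where z: "\<pi> (inv_into U \<phi> \<zeta>) = Some z" "z \<noteq> 0" by auto
    then have Gz: "G \<zeta> = inverse z" by (simp add: G_def)
    have z1: "1 \<le> cmod z" using elim(2) z by (simp only: Gz norm_inverse, simp add: divide_simps)
    have "cmod (inverse z) ^ 2 \<le> cmod (\<zeta> - \<phi> q)"
    proof -
      have "cmod (inverse z) ^ 2 / cmod (\<zeta> - \<phi> q) < 1"
        using elim(1) by (simp only: Gz norm_mult norm_divide power2_eq_square times_divide_eq_right)
      moreover have "cmod (\<zeta> - \<phi> q) > 0" using elim(4) by simp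
      ultimately have "cmod (inverse z) ^ 2 < cmod (\<zeta> - \<phi> q)" by (simp only: pos_divide_less_eq mult_1)
      then show ?thesis by simp
    qed
    then have "(cmod (inverse z) ^ 2) ^ N \<le> cmod (\<zeta> - \<phi> q) ^ N" by (intro power_mono) auto
    then have "cmod (the (g (inv_into U \<phi> \<zeta>))) * cmod (inverse z) ^ (2 * N) \<le> 1"
      using elim(5) by (auto simp: power_mult intro: order_trans[OF mult_left_mono])
    then have "cmod (the (g (inv_into U \<phi> \<zeta>))) \<le> cmod z ^ (2 * N)"
    proof -
      have "cmod (inverse z) ^ (2 * N) = inverse (cmod z ^ (2 * N))"
        by (simp only: norm_inverse power_inverse)
      moreover have "cmod z ^ (2 * N) > 0" using z by simp
      ultimately show ?thesis
        using \<open>_ * cmod (inverse z) ^ (2 * N) \<le> 1\<close> by (simp only:) (simp add: divide_simps)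
    qed
    with z1 z show ?case by simp
  qed
  then show ?thesis unfolding eventually_atin_chart[OF c(2,3)] by blast
qed

lemma growth_at_infinity:
  assumes "holomorphic_map X \<A> riemann_sphere riemann_sphere_atlas g"
  shows "\<exists>N::nat. \<forall>\<^sub>F z in at_infinity. \<forall>x\<in>fiber X \<pi> (Some z). cmod (the (g x)) \<le> cmod z ^ N"
proof -
  \<comment> \<open>The clause \<open>1 \<le> cmod (the (\<pi> x))\<close> makes
    \<open>\<Phi>\<close> monotone in the exponent.\<close>
  define \<Phi> where "\<Phi> N x \<longleftrightarrow> 1 \<le> cmod (the (\<pi> x)) \<and> cmod (the (g x)) \<le> cmod (the (\<pi> x)) ^ N" for N x
  have "\<exists>N. \<forall>\<^sub>F z in at_infinity. \<forall>x\<in>fiber X \<pi> (Some z). \<Phi> N x"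
  proof (rule eventually_fiber_at_infinity)
    show "\<Phi> D x" if "\<Phi> C x" "C \<le> D" for C D x
      using that power_increasing[of C D "cmod (the (\<pi> x))"] by (auto simp: \<Phi>_def)
    show "\<exists>N. \<forall>\<^sub>F x in atin X q. \<Phi> N x" if "q \<in> fiber X \<pi> None" for q
      using growth_near_infinity[OF that assms] by (simp add: \<Phi>_def)
  qed
  then obtain N where "\<forall>\<^sub>F z in at_infinity. \<forall>x\<in>fiber X \<pi> (Some z). \<Phi> N x" ..
  then have "\<forall>\<^sub>F z in at_infinity. \<forall>x\<in>fiber X \<pi> (Some z). cmod (the (g x)) \<le> cmod z ^ N"
    by eventually_elim (auto simp: \<Phi>_def fiber_def)
  then show ?thesis ..
qed

section \<open>Local sections and unramified fibres near infinity\<close>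

text \<open>A branch of the inverse of \<open>\<pi>\<close> through \<open>x\<close>, in the
  coordinate \<open>v = 1 / z\<close>, along which the functions in \<open>Gs\<close> are analytic.
  Convergence to \<open>x\<close> at the base point is what keeps branches through different points
  apart.\<close>

definition has_section :: "('a \<Rightarrow> complex option) set \<Rightarrow> 'a \<Rightarrow> bool" where
  "has_section Gs x \<longleftrightarrow> (\<exists>\<sigma> v. v \<noteq> 0 \<and> \<sigma> v = x \<and> \<pi> x = Some (inverse v) \<and>
     (\<forall>\<^sub>F v' in nhds v. \<sigma> v' \<in> fiber X \<pi> (Some (inverse v'))) \<and> limitin X \<sigma> x (nhds v) \<and>
     (\<forall>g\<in>Gs. (\<lambda>v. the (g (\<sigma> v))) analytic_on {v}))"

text \<open>In a punctured neighbourhood of \<open>q\<close> the derivative of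
  \<open>1 / \<pi>\<close> in a chart does not vanish and the functions in \<open>Gs\<close> are
  analytic, so a local inverse of \<open>1 / \<pi>\<close> yields the section. The same ball gives
  local injectivity.\<close>

lemma has_section_near_infinity:
  assumes q: "q \<in> fiber X \<pi> None" and fin: "finite Gs"
    and g: "\<And>g. g \<in> Gs \<Longrightarrow> holomorphic_map X \<A> riemann_sphere riemann_sphere_atlas g"
  shows "\<forall>\<^sub>F x in atin X q. has_section Gs x \<and> (\<exists>W. openin X W \<and> x \<in> W \<and> inj_on \<pi> W)"
proof -
  have "q \<in> topspace X" and q': "\<pi> q = None" using q by (auto simp: fiber_def)
  then obtain U \<phi> where c: "(U, \<phi>) \<in> \<A>" "is_chart X (U, \<phi>)" "q \<in> U" by (metis chartE)
  note inj = is_chart_inj[OF c(2)]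
  have UX: "U \<subseteq> topspace X" using c(2) openin_subset by (auto simp: is_chart_def)
  have oU: "openin X U" using c(2) by (auto simp: is_chart_def)
  define G where "G = (\<lambda>\<zeta>. inv_coord (\<pi> (inv_into U \<phi> \<zeta>)))"
  define D where "D = \<phi> ` (U \<inter> \<pi> -` (UNIV - {Some 0}))"
  have D: "open D" "G holomorphic_on D" "\<phi> q \<in> D"
    using holomorphic_map_to_sphere_chart[OF holomorphic c(1,2), of "UNIV - {Some 0}" inv_coord] q' c
    by (auto simp: riemann_sphere_atlas_eq D_def G_def)
  note ic = inv_coord_in_chart[OF c q', folded G_def]
  have G0: "G (\<phi> q) = 0" using q' c inj by (simp add: G_def)
  have "\<forall>\<^sub>F \<zeta> in at (\<phi> q). \<pi> (inv_into U \<phi> \<zeta>) \<noteq> None"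
    using eventually_finite[OF q] by (simp add: eventually_atin_chart[OF c(2,3)])
  with ic(2) have Gnz: "\<forall>\<^sub>F \<zeta> in at (\<phi> q). G \<zeta> \<noteq> 0"
    by eventually_elim (simp add: G_def inv_coord_eq_0_iff)
  have "\<forall>\<^sub>F \<zeta> in at (\<phi> q). \<forall>g\<in>Gs. (\<lambda>\<zeta>. the (g (inv_into U \<phi> \<zeta>))) analytic_on {\<zeta>}"
    using fin g meromorphic_in_chart[OF _ c]
    by (intro eventually_ball_finite) (auto intro!: meromorphic_at_imp_eventually_analytic)
  moreover note deriv_nonzero_near_zero[OF ic(1) Gnz G0]
  moreover have "\<forall>\<^sub>F \<zeta> in at (\<phi> q). \<zeta> \<in> D" using D by (intro eventually_at_in_open')
  ultimately have "\<forall>\<^sub>F \<zeta> in at (\<phi> q). has_section Gs (inv_into U \<phi> \<zeta>) \<and>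
      (\<exists>W. openin X W \<and> inv_into U \<phi> \<zeta> \<in> W \<and> inj_on \<pi> W)"
    using Gnz
  proof eventually_elim
    case (elim \<zeta>)
    define x where "x = inv_into U \<phi> \<zeta>"
    have x: "x \<in> U" "\<phi> x = \<zeta>" using elim(3) inj by (auto simp: D_def x_def inv_into_f_f)
    obtain r where r: "r > 0" "ball \<zeta> r \<subseteq> D" "open (G ` ball \<zeta> r)" "inj_on G (ball \<zeta> r)"
      using has_complex_derivative_locally_invertible[OF D(2) elim(3) D(1) elim(2)] by metis
    have holB: "G holomorphic_on ball \<zeta> r" using D(2) r(2) by (rule holomorphic_on_subset)
    obtain h where h: "h holomorphic_on G ` ball \<zeta> r" "\<And>\<xi>. \<xi> \<in> ball \<zeta> r \<Longrightarrow> h (G \<xi>) = \<xi>"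
      using holomorphic_has_inverse[OF holB open_ball r(4)] by metis
    define \<sigma> where "\<sigma> v = inv_into U \<phi> (h v)" for v
    define v where "v = G \<zeta>"
    have v: "v \<noteq> 0" "v \<in> G ` ball \<zeta> r" "h v = \<zeta>" using elim(4) h(2) r(1) by (auto simp: v_def)
    have sec: "\<sigma> v' \<in> U \<and> inv_coord (\<pi> (\<sigma> v')) = v'" if v': "v' \<in> G ` ball \<zeta> r" for v'
    proof -
      obtain \<xi> where \<xi>: "\<xi> \<in> ball \<zeta> r" "v' = G \<xi>" using v' by blast
      then have "\<xi> \<in> \<phi> ` U" using r(2) by (auto simp: D_def)
      then show ?thesis using \<xi> h(2) by (auto simp: \<sigma>_def G_def inv_into_into)
    qed
    have nB: "\<forall>\<^sub>F v' in nhds v. v' \<in> G ` ball \<zeta> r \<and> v' \<noteq> 0"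
      using r(3) v by (intro eventually_conj eventually_nhds_in_open t1_space_nhds) auto
    have hv: "h analytic_on {v}" using h(1) r(3) v(2) analytic_at by blast
    have "has_section Gs x"
      unfolding has_section_def
    proof (intro exI[of _ \<sigma>] exI[of _ v] conjI ballI)
      show "v \<noteq> 0" by fact
      show "\<sigma> v = x" by (simp add: \<sigma>_def v x_def)
      then show "\<pi> x = Some (inverse v)" using sec[OF v(2)] inv_coord_eqD[OF _ v(1)] by blast
      show "\<forall>\<^sub>F v' in nhds v. \<sigma> v' \<in> fiber X \<pi> (Some (inverse v'))"
        using nB
      proof eventually_elim
        case (elim v')
        then show ?case using sec[of v'] inv_coord_eqD[of _ v'] UX by (auto simp: fiber_def)
      qed
      show "limitin X \<sigma> x (nhds v)"
        unfolding limitin_def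
      proof (intro conjI allI impI)
        show "x \<in> topspace X" using x UX by auto
        fix W assume W: "openin X W \<and> x \<in> W"
        have "open (\<phi> ` (W \<inter> U))" using W oU by (intro is_chart_open_image[OF c(2)]) auto
        moreover have "h v \<in> \<phi> ` (W \<inter> U)" using W x v by auto
        moreover have "(h \<longlongrightarrow> h v) (nhds v)"
          using analytic_at_imp_isCont[OF hv] by (simp add: isCont_def tendsto_at_iff_tendsto_nhds)
        ultimately have "\<forall>\<^sub>F v' in nhds v. h v' \<in> \<phi> ` (W \<inter> U)" by (auto simp: tendsto_def)
        then show "\<forall>\<^sub>F v' in nhds v. \<sigma> v' \<in> W"
          by eventually_elim (use inj in \<open>auto simp: \<sigma>_def inv_into_f_f\<close>)
      qed
      fix g assume "g \<in> Gs"
      then have "(\<lambda>\<zeta>. the (g (inv_into U \<phi> \<zeta>))) analytic_on h ` {v}" using elim(1) v by simp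
      from analytic_on_compose[OF hv this] show "(\<lambda>v. the (g (\<sigma> v))) analytic_on {v}"
        by (simp add: \<sigma>_def comp_def)
    qed
    moreover have "inj_on \<pi> (U \<inter> \<phi> -` ball \<zeta> r)"
    proof (rule inj_onI)
      fix y z assume yz: "y \<in> U \<inter> \<phi> -` ball \<zeta> r" "z \<in> U \<inter> \<phi> -` ball \<zeta> r" "\<pi> y = \<pi> z"
      then have "G (\<phi> y) = G (\<phi> z)" using inj by (simp add: G_def inv_into_f_f)
      then have "\<phi> y = \<phi> z" using r yz by (auto dest: inj_onD)
      then show "y = z" using inj yz by (auto dest: inj_onD)
    qed
    moreover have "openin X (U \<inter> \<phi> -` ball \<zeta> r)" by (rule is_chart_open_vimage[OF c(2)]) simp
    moreover have "x \<in> U \<inter> \<phi> -` ball \<zeta> r" using x r by simp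
    ultimately show ?case unfolding x_def by blast
  qed
  then show ?thesis unfolding eventually_atin_chart[OF c(2,3)] .
qed

lemma has_section_at_infinity:
  assumes "finite Gs" "\<And>g. g \<in> Gs \<Longrightarrow> holomorphic_map X \<A> riemann_sphere riemann_sphere_atlas g"
  shows "\<forall>\<^sub>F z in at_infinity. \<forall>x\<in>fiber X \<pi> (Some z).
    has_section Gs x \<and> (\<exists>W. openin X W \<and> x \<in> W \<and> inj_on \<pi> W)"
  using eventually_fiber_at_infinity[of "\<lambda>_ x. has_section Gs x \<and> (\<exists>W. openin X W \<and> x \<in> W \<and> inj_on \<pi> W)"]
    has_section_near_infinity[OF _ assms] by blast

text \<open>Local injectivity at all points of the fibre gives multiplicity one, so
  \<open>Some z\<close> is not a critical value and the covering condition counts its fibre.\<close>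

lemma unramified_at_infinity:
  "\<forall>\<^sub>F z in at_infinity. card (fiber X \<pi> (Some z)) = m + 1 \<and>
     (\<forall>x\<in>fiber X \<pi> (Some z). multiplicity_at \<A> riemann_sphere_atlas \<pi> x = 1)"
proof -
  have "\<forall>\<^sub>F z in at_infinity. \<forall>x\<in>fiber X \<pi> (Some z). has_section {} x \<and> (\<exists>W. openin X W \<and> x \<in> W \<and> inj_on \<pi> W)"
    by (rule has_section_at_infinity) auto
  then show ?thesis
  proof eventually_elim
    case (elim z)
    then have mult: "multiplicity_at \<A> riemann_sphere_atlas \<pi> x = 1" if "x \<in> fiber X \<pi> (Some z)" for x
      using multiplicity_eq_1_if_locally_injective[OF surface holomorphic] that by blast
    then have "Some z \<notin> critical_values X \<A> \<pi>"
      by (fastforce simp: critical_values_def critical_points_def fiber_def)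
    then show ?case using covering mult by (simp add: branched_covering_def)
  qed
qed

section \<open>The discriminant and a lower bound for the determinant\<close>

text \<open>The discriminant of the family \<open>1, f 1, \<dots>, f m\<close> in the sense of field
  theory, in the coordinate \<open>v = 1 / z\<close>. The enumeration of the fibre is arbitrary,
  which the square makes harmless.\<close>

definition discriminant :: "(nat \<Rightarrow> 'a \<Rightarrow> complex option) \<Rightarrow> complex \<Rightarrow> complex" where
  "discriminant f v = (Determinant.det (system_matrix m f
     (SOME e. bij_betw e {0..m} (fiber X \<pi> (Some (inverse v))))))\<^sup>2"

lemma discriminant_eq:
  assumes "bij_betw e {0..m} (fiber X \<pi> (Some (inverse v)))"
  shows "discriminant f v = (Determinant.det (system_matrix m f e))\<^sup>2"
  unfolding discriminant_def
  by (rule det_system_matrix_power2_eq[OF someI[of "\<lambda>e. bij_betw e {0..m} _", OF assms] assms])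

text \<open>Near \<open>v\<close> the local sections through the points of the fibre enumerate the
  neighbouring fibres, and along them the matrix has analytic entries.\<close>

lemma discriminant_analytic:
  assumes f: "\<And>j. j \<in> {1..m} \<Longrightarrow> holomorphic_map X \<A> riemann_sphere riemann_sphere_atlas (f j)"
  shows "\<forall>\<^sub>F v in at 0. discriminant f analytic_on {v}"
proof -
  have "\<forall>\<^sub>F z in at_infinity. \<forall>x\<in>fiber X \<pi> (Some z).
      has_section (f ` {1..m}) x \<and> (\<exists>W. openin X W \<and> x \<in> W \<and> inj_on \<pi> W)"
    using f by (intro has_section_at_infinity) auto
  then have "\<forall>\<^sub>F z in at_infinity. \<forall>x\<in>fiber X \<pi> (Some z). has_section (f ` {1..m}) x"
    by (rule eventually_mono) blast
  then have sec: "\<forall>\<^sub>F v in at 0. \<forall>x\<in>fiber X \<pi> (Some (inverse v)). has_section (f ` {1..m}) x"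
    by (simp add: eventually_at_0_iff_at_infinity)
  have card: "\<forall>\<^sub>F v in at 0. card (fiber X \<pi> (Some (inverse v))) = m + 1"
    using unramified_at_infinity by (auto simp: eventually_at_0_iff_at_infinity elim: eventually_mono)
  from sec card eventually_at_imp_eventually_nhds[OF card] show ?thesis
  proof eventually_elim
    case (elim v)
    let ?F = "\<lambda>v. fiber X \<pi> (Some (inverse v))"
    have "finite (?F v)" using elim(2) by (rule_tac card_ge_0_finite) simp
    then obtain e where e: "bij_betw e {0..m} (?F v)"
      using ex_bij_betw_nat_finite[of "?F v"] elim(2) by (auto simp: atLeastLessThanSuc_atLeastAtMost)
    define sec where "sec l \<sigma> \<longleftrightarrow> \<sigma> v = e l \<and> (\<forall>\<^sub>F v' in nhds v. \<sigma> v' \<in> ?F v') \<and> limitin X \<sigma> (e l) (nhds v) \<and>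
        (\<forall>j\<in>{1..m}. (\<lambda>v. the (f j (\<sigma> v))) analytic_on {v})" for l \<sigma>
    have "\<forall>l\<in>{0..m}. \<exists>\<sigma>. sec l \<sigma>"
    proof
      fix l assume "l \<in> {0..m}"
      then have mem: "e l \<in> ?F v" using bij_betwE[OF e] by simp
      then obtain \<sigma> v1 where \<sigma>: "v1 \<noteq> 0" "\<sigma> v1 = e l" "\<pi> (e l) = Some (inverse v1)"
         "\<forall>\<^sub>F v' in nhds v1. \<sigma> v' \<in> ?F v'" "limitin X \<sigma> (e l) (nhds v1)"
         "\<forall>g\<in>f ` {1..m}. (\<lambda>v. the (g (\<sigma> v))) analytic_on {v1}"
        using elim(1) unfolding has_section_def by blast
      \<comment> \<open>The parameter of a section is determined by the point it passes
        through.\<close>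
      moreover have "v1 = v" using \<sigma>(3) mem by (simp add: fiber_def)
      ultimately have "sec l \<sigma>" by (auto simp: sec_def)
      then show "\<exists>\<sigma>. sec l \<sigma>" by (rule exI[where P = "sec l"])
    qed
    from bchoice[OF this] obtain \<sigma> where "\<forall>l\<in>{0..m}. sec l (\<sigma> l)" by blast
    then have \<sigma>: "\<And>l. l \<le> m \<Longrightarrow> \<sigma> l v = e l"
       "\<And>l. l \<le> m \<Longrightarrow> \<forall>\<^sub>F v' in nhds v. \<sigma> l v' \<in> ?F v'"
       "\<And>l. l \<le> m \<Longrightarrow> limitin X (\<sigma> l) (e l) (nhds v)"
       "\<And>l j. l \<le> m \<Longrightarrow> j \<in> {1..m} \<Longrightarrow> (\<lambda>v. the (f j (\<sigma> l v))) analytic_on {v}"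
      by (simp_all add: sec_def)
    \<comment> \<open>Sections converge to their base points, and distinct base points have disjoint
      neighbourhoods.\<close>
    have "\<forall>\<^sub>F v' in nhds v. \<sigma> l v' \<noteq> \<sigma> l' v'" if ll: "l \<le> m" "l' \<le> m" "l \<noteq> l'" for l l'
    proof -
      have "e l \<noteq> e l'" "e l \<in> topspace X" "e l' \<in> topspace X"
        using e ll by (auto simp: bij_betw_def inj_on_eq_iff fiber_def)
      then obtain A B where AB: "openin X A" "openin X B" "e l \<in> A" "e l' \<in> B" "disjnt A B"
        using surface unfolding riemann_surface_def Hausdorff_space_def by metis
      have "\<forall>\<^sub>F v' in nhds v. \<sigma> l v' \<in> A" "\<forall>\<^sub>F v' in nhds v. \<sigma> l' v' \<in> B"
        using AB \<sigma>(3) ll by (auto simp: limitin_def)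
      then show ?thesis by eventually_elim (use AB in \<open>auto simp: disjnt_iff\<close>)
    qed
    then have "\<forall>\<^sub>F v' in nhds v. \<forall>l\<in>{0..m}. \<forall>l'\<in>{0..m}. l \<noteq> l' \<longrightarrow> \<sigma> l v' \<noteq> \<sigma> l' v'"
      by (intro eventually_ball_finite ballI) (auto simp: eventually_conj_iff)
    moreover have "\<forall>\<^sub>F v' in nhds v. \<forall>l\<in>{0..m}. \<sigma> l v' \<in> ?F v'"
      using \<sigma>(2) by (intro eventually_ball_finite) auto
    ultimately have ev: "\<forall>\<^sub>F v' in nhds v. (Determinant.det (system_matrix m f (\<lambda>l. \<sigma> l v')))\<^sup>2 = discriminant f v'"
      using elim(3)
    proof eventually_elim
      case (elim v')
      have inj: "inj_on (\<lambda>l. \<sigma> l v') {0..m}" using elim(1) by (auto simp: inj_on_def)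
      \<comment> \<open>These are \<open>m + 1\<close> distinct points in a fibre of
        \<open>m + 1\<close> points.\<close>
      have "(\<lambda>l. \<sigma> l v') ` {0..m} = ?F v'"
      proof (rule card_subset_eq)
        show "finite (?F v')" using elim(3) by (rule_tac card_ge_0_finite) simp
        show "(\<lambda>l. \<sigma> l v') ` {0..m} \<subseteq> ?F v'" using elim(2) by auto
        show "card ((\<lambda>l. \<sigma> l v') ` {0..m}) = card (?F v')" using elim(3) inj by (simp add: card_image)
      qed
      with inj have "bij_betw (\<lambda>l. \<sigma> l v') {0..m} (?F v')" by (simp add: bij_betw_def)
      from discriminant_eq[OF this] show ?case by simp
    qed
    have "(\<lambda>v'. (Determinant.det (system_matrix m f (\<lambda>l. \<sigma> l v')))\<^sup>2) analytic_on {v}"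
    proof (intro analytic_on_power det_analytic_at[OF system_matrix_carrier])
      fix i j assume ij: "i < m + 1" "j < m + 1"
      then show "(\<lambda>v'. system_matrix m f (\<lambda>l. \<sigma> l v') $$ (i, j)) analytic_on {v}"
        using \<sigma>(4)[of i j] by (cases "j = 0") (auto simp: col_def)
    qed
    then show ?case using analytic_at_cong[OF ev refl] by (rule iffD1[rotated])
  qed
qed

lemma col_growth_at_infinity:
  assumes f: "\<And>j. j \<in> {1..m} \<Longrightarrow> holomorphic_map X \<A> riemann_sphere riemann_sphere_atlas (f j)"
  shows "\<exists>N::nat. \<forall>\<^sub>F z in at_infinity. \<forall>x\<in>fiber X \<pi> (Some z). \<forall>j\<in>{0..m}. cmod (col f j x) \<le> cmod z ^ N"
proof -
  have "\<forall>j\<in>{1..m}. \<exists>N::nat. \<forall>\<^sub>F z in at_infinity. \<forall>x\<in>fiber X \<pi> (Some z). cmod (the (f j x)) \<le> cmod z ^ N"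
    by (intro ballI growth_at_infinity f)
  from bchoice[OF this] obtain N :: "nat \<Rightarrow> nat" where N: "\<forall>j\<in>{1..m}.
      \<forall>\<^sub>F z in at_infinity. \<forall>x\<in>fiber X \<pi> (Some z). cmod (the (f j x)) \<le> cmod z ^ N j"
    by blast
  define M where "M = (\<Sum>j\<in>{1..m}. N j)"
  have M: "N j \<le> M" if "j \<in> {1..m}" for j
    using that by (auto simp: M_def intro: member_le_sum)
  have "\<forall>\<^sub>F z in at_infinity. \<forall>j\<in>{1..m}. \<forall>x\<in>fiber X \<pi> (Some z). cmod (the (f j x)) \<le> cmod z ^ N j"
    using N by (intro eventually_ball_finite) simp
  moreover have "\<forall>\<^sub>F z in at_infinity. 1 \<le> cmod z"
    by (auto simp: eventually_at_infinity)
  ultimately have "\<forall>\<^sub>F z in at_infinity. \<forall>x\<in>fiber X \<pi> (Some z). \<forall>j\<in>{0..m}. cmod (col f j x) \<le> cmod z ^ M"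
  proof eventually_elim
    case (elim z)
    show ?case
    proof (intro ballI)
      fix x j assume x: "x \<in> fiber X \<pi> (Some z)" and j: "j \<in> {0..m}"
      show "cmod (col f j x) \<le> cmod z ^ M"
      proof (cases "j = 0")
        case True
        then show ?thesis using elim(2) by (simp add: col_def)
      next
        case False
        with j have j': "j \<in> {1..m}" by auto
        then have "cmod (the (f j x)) \<le> cmod z ^ N j" using elim(1) x by blast
        also have "\<dots> \<le> cmod z ^ M" using M[OF j'] elim(2) by (rule power_increasing)
        finally show ?thesis using False by (simp add: col_def)
      qed
    qed
  qed
  then show ?thesis by blast
qed

text \<open>The discriminant is analytic in a punctured neighbourhood of \<open>0\<close> and grows
  polynomially in \<open>1 / v\<close>, hence is meromorphic at \<open>0\<close>. Its lower bound
  passes to the determinant for every enumeration of the fibre.\<close>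

lemma det_lower_bound_at_infinity:
  assumes f: "\<And>j. j \<in> {1..m} \<Longrightarrow> holomorphic_map X \<A> riemann_sphere riemann_sphere_atlas (f j)"
  shows "\<exists>N::nat. \<forall>\<^sub>F z in at_infinity. \<forall>e. bij_betw e {0..m} (fiber X \<pi> (Some z)) \<longrightarrow>
    Determinant.det (system_matrix m f e) = 0 \<or> 1 \<le> cmod (Determinant.det (system_matrix m f e)) * cmod z ^ N"
proof -
  obtain N :: nat where N: "\<forall>\<^sub>F z in at_infinity. \<forall>x\<in>fiber X \<pi> (Some z). \<forall>j\<in>{0..m}. cmod (col f j x) \<le> cmod z ^ N"
    using col_growth_at_infinity[of f] f by blast
  \<comment> \<open>Each term of the determinant has \<open>m + 1\<close> factors of size at most
    \<open>cmod z ^ N\<close>, and the discriminant is a square.\<close>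
  define M where "M = (N * (m + 1)) * 2"
  have card: "\<forall>\<^sub>F z in at_infinity. card (fiber X \<pi> (Some z)) = m + 1"
    using unramified_at_infinity by (auto elim: eventually_mono)
  have nz: "\<forall>\<^sub>F z in at_infinity. 1 \<le> cmod z" by (auto simp: eventually_at_infinity)
  have "\<forall>\<^sub>F z in at_infinity. cmod (discriminant f (inverse z)) * cmod (inverse z) ^ M \<le> (fact (m + 1))\<^sup>2"
    using N card nz
  proof eventually_elim
    case (elim z)
    have "finite (fiber X \<pi> (Some z))" using elim(2) by (rule_tac card_ge_0_finite) simp
    then obtain e where e: "bij_betw e {0..m} (fiber X \<pi> (Some z))"
      using ex_bij_betw_nat_finite[of "fiber X \<pi> (Some z)"] elim(2)
      by (auto simp: atLeastLessThanSuc_atLeastAtMost)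
    have "cmod (Determinant.det (system_matrix m f e)) \<le> fact (m + 1) * (cmod z ^ N) ^ (m + 1)"
      using elim(1) bij_betwE[OF e] by (intro norm_det_le[OF system_matrix_carrier]) auto
    then have "cmod (Determinant.det (system_matrix m f e)) ^ 2 \<le> (fact (m + 1) * (cmod z ^ N) ^ (m + 1)) ^ 2"
      by (intro power_mono) auto
    moreover have "discriminant f (inverse z) = (Determinant.det (system_matrix m f e))\<^sup>2"
      using e by (intro discriminant_eq) simp
    ultimately have "cmod (discriminant f (inverse z)) \<le> (fact (m + 1))\<^sup>2 * cmod z ^ M"
      by (simp only: M_def norm_power power_mult_distrib power_mult)
    moreover have "cmod (inverse z) ^ M = inverse (cmod z ^ M)" by (simp only: norm_inverse power_inverse)
    moreover have "cmod z ^ M > 0" using elim(3) by (intro zero_less_power) linarith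
    ultimately show ?case by (simp only: pos_divide_le_eq flip: divide_inverse)
  qed
  then have "\<forall>\<^sub>F v in at 0. cmod (discriminant f v) * cmod v ^ M \<le> (fact (m + 1))\<^sup>2"
    by (simp only: eventually_at_0_iff_at_infinity)
  with discriminant_analytic[OF f] have mero: "discriminant f meromorphic_on {0}"
    by (rule meromorphic_at_0_if_bounded)
  have "\<exists>N. \<forall>\<^sub>F v in at 0. discriminant f v = 0 \<or> cmod v ^ N \<le> cmod (discriminant f v)"
  proof (cases "\<exists>\<^sub>F v in at 0. discriminant f v \<noteq> 0")
    case True
    from meromorphic_at_lower_bound[OF mero this] show ?thesis by (auto elim: eventually_mono)
  next
    \<comment> \<open>A discriminant vanishing identically near \<open>0\<close> falls under the
      first alternative.\<close>
    case False
    then show ?thesis by (auto simp: not_frequently elim: eventually_mono)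
  qed
  then obtain K where "\<forall>\<^sub>F z in at_infinity. discriminant f (inverse z) = 0 \<or>
      cmod (inverse z) ^ K \<le> cmod (discriminant f (inverse z))"
    unfolding eventually_at_0_iff_at_infinity by blast
  with nz have "\<forall>\<^sub>F z in at_infinity. \<forall>e. bij_betw e {0..m} (fiber X \<pi> (Some z)) \<longrightarrow>
    Determinant.det (system_matrix m f e) = 0 \<or> 1 \<le> cmod (Determinant.det (system_matrix m f e)) * cmod z ^ K"
  proof eventually_elim
    case (elim z)
    show ?case
    proof (intro allI impI)
      fix e assume e: "bij_betw e {0..m} (fiber X \<pi> (Some z))"
      define d where "d = Determinant.det (system_matrix m f e)"
      have disc: "discriminant f (inverse z) = d\<^sup>2"
        unfolding d_def using e by (intro discriminant_eq) simp
      show "d = 0 \<or> 1 \<le> cmod d * cmod z ^ K"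
      proof (cases "d = 0")
        case False
        have z: "cmod z ^ K \<ge> 1" using elim(1) by (rule one_le_power)
        have "inverse (cmod z ^ K) \<le> cmod d ^ 2"
          using elim(2) False by (simp only: disc norm_power norm_inverse power_inverse) simp
        then have "1 \<le> cmod d ^ 2 * cmod z ^ K" using z by (simp add: field_simps)
        \<comment> \<open>Doubling the exponent of \<open>z\<close> makes the right side a square,
          so a root can be taken without halving \<open>K\<close>.\<close>
        also have "\<dots> \<le> cmod d ^ 2 * (cmod z ^ K) ^ 2"
          using z by (intro mult_left_mono) (auto simp: power2_eq_square)
        finally have "1 ^ 2 \<le> (cmod d * cmod z ^ K) ^ 2" by (simp add: power_mult_distrib)
        then show ?thesis by (intro disjI2 power2_le_imp_le[of 1]) auto
      qed simp
    qed
  qed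
  then show ?thesis by blast
qed

end

section \<open>The Nuttall sheets\<close>

context sphere_covering
begin

lemma local_inverse_at_infinityE:
  assumes "local_inverse_at_infinity X \<pi> p s"
  shows "\<forall>\<^sub>F z in at_infinity. s (Some z) \<in> fiber X \<pi> (Some z)"
    and "\<And>W. openin X W \<Longrightarrow> p \<in> W \<Longrightarrow> \<exists>V. openin riemann_sphere V \<and> None \<in> V \<and>
      (\<forall>z\<in>V. s z \<in> W \<and> \<pi> (s z) = z)"
proof -
  obtain V where V: "openin riemann_sphere V" "None \<in> V"
      "continuous_map (subtopology riemann_sphere V) X s" "s None = p" "\<forall>z\<in>V. \<pi> (s z) = z"
    using assms by (auto simp: local_inverse_at_infinity_def)
  show "\<exists>V. openin riemann_sphere V \<and> None \<in> V \<and> (\<forall>z\<in>V. s z \<in> W \<and> \<pi> (s z) = z)"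
    if W: "openin X W" "p \<in> W" for W
  proof -
    have "openin (subtopology riemann_sphere V) {z \<in> topspace (subtopology riemann_sphere V). s z \<in> W}"
      using V(3) W(1) by (rule openin_continuous_map_preimage)
    then have "openin riemann_sphere {z \<in> V. s z \<in> W}"
      using V(1) by (simp add: openin_open_subtopology)
    then show ?thesis using V W by blast
  qed
  from this[of "topspace X"] V(2-4) have "\<exists>V. openin riemann_sphere V \<and> None \<in> V \<and>
      (\<forall>z\<in>V. s z \<in> topspace X \<and> \<pi> (s z) = z)"
    using continuous_map_image_subset_topspace[OF V(3)] by fastforce
  then obtain V' where V': "openin riemann_sphere V'" "None \<in> V'" "\<forall>z\<in>V'. s z \<in> topspace X \<and> \<pi> (s z) = z"
    by blast
  from eventually_openin_riemann_sphere[OF this(1,2)]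
  show "\<forall>\<^sub>F z in at_infinity. s (Some z) \<in> fiber X \<pi> (Some z)"
    by eventually_elim (use V'(3) in \<open>auto simp: fiber_def\<close>)
qed

text \<open>\<open>\<pi>\<close> is injective near the noncritical point \<open>p\<close>, and near
  infinity \<open>s\<close> takes values in that neighbourhood; there \<open>x\<close> and
  \<open>s (\<pi> x)\<close> have the same image.\<close>

lemma eventually_eq_local_inverse:
  assumes p: "p \<in> fiber X \<pi> None" "p \<notin> critical_points X \<A> \<pi>"
    and s: "local_inverse_at_infinity X \<pi> p s"
  shows "\<forall>\<^sub>F x in atin X p. x = s (\<pi> x)"
proof -
  have pX: "p \<in> topspace X" "\<pi> p = None" using p by (auto simp: fiber_def)
  have "multiplicity_at \<A> riemann_sphere_atlas \<pi> p \<le> 1"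
    using p(2) pX by (auto simp: critical_points_def)
  moreover have "\<forall>\<^sub>F y in atin X p. \<pi> y \<noteq> \<pi> p" using eventually_finite[OF p(1)] pX by simp
  ultimately obtain W where W: "openin X W" "p \<in> W" "inj_on \<pi> W"
    using locally_injective_if_multiplicity_le_1[OF surface holomorphic pX(1)] by metis
  obtain V where V: "openin riemann_sphere V" "None \<in> V" "\<And>z. z \<in> V \<Longrightarrow> s z \<in> W \<and> \<pi> (s z) = z"
    using local_inverse_at_infinityE(2)[OF s W(1,2)] by blast
  have "openin X (W \<inter> {x \<in> topspace X. \<pi> x \<in> V})" using W(1) openin_vimage[OF V(1)] by (rule openin_Int)
  moreover have "p \<in> W \<inter> {x \<in> topspace X. \<pi> x \<in> V}" using W pX V by simp
  moreover have "x = s (\<pi> x)" if "x \<in> W \<inter> {x \<in> topspace X. \<pi> x \<in> V}" for x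
    using that V(3)[of "\<pi> x"] W(3) by (auto dest: inj_onD)
  ultimately show ?thesis unfolding eventually_atin by blast
qed

text \<open>Near \<open>p\<close> the function \<open>u\<close> tends to \<open>-\<infinity>\<close>, near all other points over infinity to \<open>\<infinity>\<close>.\<close>

lemma nuttall_function_min:
  assumes p: "p \<in> fiber X \<pi> None" "p \<notin> critical_points X \<A> \<pi>"
    and s: "local_inverse_at_infinity X \<pi> p s" and u: "nuttall_function X \<A> m \<pi> p u"
  shows "\<forall>\<^sub>F z in at_infinity. \<forall>x\<in>fiber X \<pi> (Some z). x \<noteq> s (Some z) \<longrightarrow> u (s (Some z)) < u x"
proof -
  \<comment> \<open>Near \<open>p\<close> the first alternative holds, near the other points over
    infinity the second; compactness gives one constant for all.\<close>
  define \<Phi> where "\<Phi> C x \<longleftrightarrow> x = s (\<pi> x) \<or> ln (cmod (the (\<pi> x))) - real C \<le> u x" for C x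
  have "\<exists>C. \<forall>\<^sub>F z in at_infinity. \<forall>x\<in>fiber X \<pi> (Some z). \<Phi> C x"
  proof (rule eventually_fiber_at_infinity)
    show "\<Phi> D x" if "\<Phi> C x" "C \<le> D" for C D x
      using that by (auto simp: \<Phi>_def)
    show "\<exists>C. \<forall>\<^sub>F x in atin X q. \<Phi> C x" if q: "q \<in> fiber X \<pi> None" for q
    proof (cases "q = p")
      case True
      with eventually_eq_local_inverse[OF p s] show ?thesis
        by (auto simp: \<Phi>_def elim: eventually_mono)
    next
      case False
      then have "(\<lambda>x. u x - ln (cmod (the (\<pi> x)))) \<in> O[atin X q](\<lambda>_. 1)"
        using u q by (auto simp: nuttall_function_def)
      then obtain c where c: "\<forall>\<^sub>F x in atin X q. \<bar>u x - ln (cmod (the (\<pi> x)))\<bar> \<le> c"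
        by (elim landau_o.bigE) auto
      obtain C where "c \<le> real C" using real_arch_simple by blast
      with c have "\<forall>\<^sub>F x in atin X q. \<Phi> C x"
        by (auto simp: \<Phi>_def elim!: eventually_mono)
      then show ?thesis ..
    qed
  qed
  then obtain C where C: "\<forall>\<^sub>F z in at_infinity. \<forall>x\<in>fiber X \<pi> (Some z). \<Phi> C x" ..
  have "(\<lambda>x. u x + real m * ln (cmod (the (\<pi> x)))) \<in> O[atin X p](\<lambda>_. 1)"
    using u by (auto simp: nuttall_function_def)
  then obtain c where c: "\<forall>\<^sub>F x in atin X p. \<bar>u x + real m * ln (cmod (the (\<pi> x)))\<bar> \<le> c"
    by (elim landau_o.bigE) auto
  then obtain W where W: "openin X W" "p \<in> W"
      "\<And>x. x \<in> W - {p} \<Longrightarrow> \<bar>u x + real m * ln (cmod (the (\<pi> x)))\<bar> \<le> c"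
    using p(1) unfolding eventually_atin fiber_def by blast
  obtain V where V: "openin riemann_sphere V" "None \<in> V" "\<And>z. z \<in> V \<Longrightarrow> s z \<in> W \<and> \<pi> (s z) = z"
    using local_inverse_at_infinityE(2)[OF s W(1,2)] by blast
  have "filterlim (\<lambda>z :: complex. ln (cmod z)) at_top at_infinity"
    by (rule filterlim_compose[OF ln_at_top filterlim_norm_at_top])
  \<comment> \<open>Positivity of the logarithm bounds \<open>u\<close> along \<open>s\<close> by
    \<open>c\<close>, and its size lifts \<open>u\<close> above \<open>c\<close> at all other points
    of the fibre.\<close>
  then have "\<forall>\<^sub>F z :: complex in at_infinity. ln (cmod z) > max 0 (c + real C)"
    unfolding filterlim_at_top_dense by blast
  with C eventually_openin_riemann_sphere[OF V(1,2)] show ?thesis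
  proof eventually_elim
    case (elim z)
    have sz: "s (Some z) \<in> W" "\<pi> (s (Some z)) = Some z" using V(3) elim(2) by auto
    then have "s (Some z) \<noteq> p" using p(1) by (auto simp: fiber_def)
    then have "\<bar>u (s (Some z)) + real m * ln (cmod z)\<bar> \<le> c" using W(3)[of "s (Some z)"] sz by auto
    moreover have "real m * ln (cmod z) \<ge> 0" using elim(3) by simp
    ultimately have "u (s (Some z)) \<le> c" by linarith
    then show ?case using elim(1,3) by (auto simp: \<Phi>_def fiber_def)
  qed
qed

section \<open>The sheets over unramified points\<close>

text \<open>Outside the Nuttall set the ordered values increase strictly, so \<open>u\<close> is
  injective on the fibre and the description defining \<open>sheet\<close> is unique. The point with
  the least value gets the number \<open>0\<close>.\<close>

lemma sheet_bij_betw: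
  assumes card: "card (fiber X \<pi> (Some z)) = m + 1"
    and mult: "\<forall>x\<in>fiber X \<pi> (Some z). multiplicity_at \<A> riemann_sphere_atlas \<pi> x = 1"
    and z: "Some z \<notin> nuttall_set X \<A> m \<pi> u"
  shows "bij_betw (sheet X \<A> \<pi> u (Some z)) {0..m} (fiber X \<pi> (Some z))"
    and "\<And>x. x \<in> fiber X \<pi> (Some z) \<Longrightarrow>
      \<forall>y\<in>fiber X \<pi> (Some z). y \<noteq> x \<longrightarrow> u x < u y \<Longrightarrow> sheet X \<A> \<pi> u (Some z) 0 = x"
proof -
  let ?S = "fiber X \<pi> (Some z)"
  let ?h = "\<lambda>x. ereal (u x)"
  have fin: "finite ?S" using card by (rule_tac card_ge_0_finite) simp
  define M where "M = image_mset ?h (mset_set ?S)"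
  define xs where "xs = sorted_list_of_multiset M"
  have height: "height X \<pi> u x = ?h x" if "x \<in> ?S" for x
    using that by (auto simp: height_def fiber_def)
  have "(\<Sum>x\<in>?S. replicate_mset (multiplicity_at \<A> riemann_sphere_atlas \<pi> x) (height X \<pi> u x)) = (\<Sum>x\<in>?S. {#?h x#})"
    using mult height by (intro sum.cong) auto
  also have "\<dots> = M"
  proof -
    have "(\<Sum>x\<in>T. {#?h x#}) = image_mset ?h (mset_set T)" if "finite T" for T
      using that by (induction T) auto
    then show ?thesis using fin by (simp add: M_def)
  qed
  finally have ov: "ordered_value X \<A> \<pi> u j (Some z) = xs ! j" for j
    by (simp add: ordered_value_def xs_def)
  have mset: "mset xs = M" by (simp add: xs_def)
  have len: "length xs = m + 1"
    using arg_cong[OF mset, of size] card by (simp add: M_def)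
  have set: "set xs = ?h ` ?S"
    using arg_cong[OF mset, of set_mset] fin by (simp add: M_def)
  have sorted: "sorted xs" by (simp add: xs_def)
  \<comment> \<open>The sets whose union is \<open>nuttall_set\<close> are indexed from
    \<open>1\<close>: the pair \<open>j\<close>, \<open>Suc j\<close> belongs to index
    \<open>Suc j\<close>.\<close>
  have neq: "xs ! j \<noteq> xs ! Suc j" if "Suc j < length xs" for j
  proof -
    have "Suc j \<in> {1..m}" using that len by simp
    then have "ordered_value X \<A> \<pi> u (Suc j - 1) (Some z) \<noteq> ordered_value X \<A> \<pi> u (Suc j) (Some z)"
      using z unfolding nuttall_set_def by blast
    then show ?thesis by (simp add: ov)
  qed
  have strict: "sorted_wrt (<) xs"
    using sorted neq by (subst sorted_wrt_iff_nth_Suc_transp) (auto simp: sorted_iff_nth_Suc order_less_le)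
  then have dist: "distinct xs" by (simp add: strict_sorted_iff)
  \<comment> \<open>The \<open>m + 1\<close> distinct values are the image of a fibre of
    \<open>m + 1\<close> points, which forces injectivity.\<close>
  have "card (?h ` ?S) = card ?S"
    using distinct_card[OF dist] len set card by simp
  then have inj: "inj_on ?h ?S" using fin by (rule eq_card_imp_inj_on[rotated])
  have "{0..m} = {..<length xs}" using len by auto
  from bij_betw_nth[OF dist this set[symmetric]]
  have b1: "bij_betw (\<lambda>j. xs ! j) {0..m} (?h ` ?S)" .
  have sheet: "sheet X \<A> \<pi> u (Some z) j = inv_into ?S ?h (xs ! j)" if "j \<in> {0..m}" for j
    unfolding sheet_def ov
  proof (rule the_equality)
    have "xs ! j \<in> ?h ` ?S" using bij_betwE[OF b1] that by blast
    then show "inv_into ?S ?h (xs ! j) \<in> ?S \<and> height X \<pi> u (inv_into ?S ?h (xs ! j)) = xs ! j"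
      using inv_into_into[of "xs ! j" ?h ?S] f_inv_into_f[of "xs ! j" ?h ?S] height by auto
  next
    fix x assume "x \<in> ?S \<and> height X \<pi> u x = xs ! j"
    then have "x \<in> ?S" "?h x = xs ! j" using height by auto
    then show "x = inv_into ?S ?h (xs ! j)" using inv_into_f_f[OF inj] by metis
  qed
  have "bij_betw (inv_into ?S ?h \<circ> (\<lambda>j. xs ! j)) {0..m} ?S"
    using inj b1 by (intro bij_betw_trans[OF b1] bij_betw_inv_into) (simp add: bij_betw_def)
  then show bij: "bij_betw (sheet X \<A> \<pi> u (Some z)) {0..m} ?S"
    by (rule bij_betw_cong[THEN iffD1, rotated]) (simp add: sheet)
  fix x assume x: "x \<in> ?S" and min: "\<forall>y\<in>?S. y \<noteq> x \<longrightarrow> u x < u y"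
  define y where "y = sheet X \<A> \<pi> u (Some z) 0"
  have y: "y \<in> ?S" using bij_betwE[OF bij] by (simp add: y_def)
  have "?h x \<in> set xs" using x set by simp
  then obtain i where "i < length xs" "?h x = xs ! i" by (metis in_set_conv_nth)
  then have "xs ! 0 \<le> ?h x" using sorted by (metis le0 sorted_nth_mono)
  moreover have "?h y = xs ! 0"
    using sheet[of 0] f_inv_into_f[of "xs ! 0" ?h ?S] bij_betwE[OF b1] by (simp add: y_def)
  ultimately have "\<not> u x < u y" by (metis ereal_less_eq(3) not_le)
  then show "sheet X \<A> \<pi> u (Some z) 0 = x" using min y unfolding y_def by blast
qed

section \<open>Growth of the coefficients\<close>

text \<open>Growth bounds for the entries control the minor and the Vandermonde product, the lower
  bound for the determinant controls its reciprocal; the constants are uniform in the enumeration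
  and in \<open>L\<close> and \<open>K\<close>.\<close>

lemma coefficient_bound:
  assumes f: "\<And>j. j \<in> {1..m} \<Longrightarrow> holomorphic_map X \<A> riemann_sphere riemann_sphere_atlas (f j)"
    and w: "holomorphic_map X \<A> riemann_sphere riemann_sphere_atlas w"
  shows "\<exists>C (p::nat). \<forall>\<^sub>F z in at_infinity. \<forall>e L K. bij_betw e {0..m} (fiber X \<pi> (Some z)) \<longrightarrow>
    L \<in> multi_indices m k \<longrightarrow> 0 \<notin> L \<longrightarrow> K \<in> multi_indices m (Suc k) \<longrightarrow>
    cmod (Determinant.det (submatrix (system_matrix m f e) ({0..m} - L - {0}) ({0..m} - K)) *
      vandermonde_product w e L / Determinant.det (system_matrix m f e)) \<le> C * cmod z ^ p"
proof -
  obtain N1 :: nat where N1: "\<forall>\<^sub>F z in at_infinity. \<forall>x\<in>fiber X \<pi> (Some z). \<forall>j\<in>{0..m}. cmod (col f j x) \<le> cmod z ^ N1"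
    using col_growth_at_infinity[of f] f by blast
  obtain N2 :: nat where N2: "\<forall>\<^sub>F z in at_infinity. \<forall>x\<in>fiber X \<pi> (Some z). cmod (the (w x)) \<le> cmod z ^ N2"
    using growth_at_infinity[OF w] by blast
  obtain N3 :: nat where N3: "\<forall>\<^sub>F z in at_infinity. \<forall>e. bij_betw e {0..m} (fiber X \<pi> (Some z)) \<longrightarrow>
    Determinant.det (system_matrix m f e) = 0 \<or> 1 \<le> cmod (Determinant.det (system_matrix m f e)) * cmod z ^ N3"
    using det_lower_bound_at_infinity[of f] f by blast
  have nz: "\<forall>\<^sub>F z in at_infinity. 1 \<le> cmod z" by (auto simp: eventually_at_infinity)
  \<comment> \<open>The size of the minors: \<open>k\<close> rows and row \<open>0\<close> are
    deleted, against \<open>k + 1\<close> columns.\<close>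
  define n where "n = m - k"
  define C :: real where "C = fact n * 2 ^ (m + 1)\<^sup>2"
  define p where "p = N1 * n + N2 * (m + 1)\<^sup>2 + N3"
  have "\<forall>\<^sub>F z in at_infinity. \<forall>e L K. bij_betw e {0..m} (fiber X \<pi> (Some z)) \<longrightarrow>
    L \<in> multi_indices m k \<longrightarrow> 0 \<notin> L \<longrightarrow> K \<in> multi_indices m (Suc k) \<longrightarrow>
    cmod (Determinant.det (submatrix (system_matrix m f e) ({0..m} - L - {0}) ({0..m} - K)) *
      vandermonde_product w e L / Determinant.det (system_matrix m f e)) \<le> C * cmod z ^ p"
    using N1 N2 N3 nz
  proof eventually_elim
    case (elim z)
    show ?case
    proof (intro allI impI)
      fix e L K
      assume e: "bij_betw e {0..m} (fiber X \<pi> (Some z))" and L: "L \<in> multi_indices m k" "0 \<notin> L"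
        and K: "K \<in> multi_indices m (Suc k)"
      let ?M = "system_matrix m f e"
      have L': "L \<subseteq> {0..m}" "card L = k" "finite L" and K': "K \<subseteq> {0..m}" "card K = Suc k" "finite K"
        using L K by (auto simp: multi_indices_def finite_subset[of _ "{0..m}"])
      have "card ({0..m} - L - {0}) = n"
        using L' L(2) by (simp add: card_Diff_subset card_Diff_singleton n_def)
      moreover have "card ({0..m} - K) = n" using K' by (simp add: card_Diff_subset n_def)
      moreover have "cmod (?M $$ (i, j)) \<le> cmod z ^ N1" if "i \<in> {0..m}" "j \<in> {0..m}" for i j
        using elim(1) bij_betwE[OF e] that by simp
      ultimately have d: "cmod (Determinant.det (submatrix ?M ({0..m} - L - {0}) ({0..m} - K)))
          \<le> fact n * (cmod z ^ N1) ^ n"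
        by (intro norm_det_submatrix_le) (auto simp: system_matrix_def)
      have v: "cmod (vandermonde_product w e L) \<le> (2 * cmod z ^ N2) ^ (m + 1)\<^sup>2"
        using elim(2,4) bij_betwE[OF e] L' by (intro vandermonde_product_bound) auto
      \<comment> \<open>A vanishing determinant satisfies the bound since
        \<open>inverse 0 = 0\<close>.\<close>
      have q: "cmod (inverse (Determinant.det ?M)) \<le> cmod z ^ N3"
      proof (cases "Determinant.det ?M = 0")
        case False
        with elim(3) e have "1 \<le> cmod (Determinant.det ?M) * cmod z ^ N3" by blast
        with False show ?thesis by (simp only: norm_inverse) (simp add: inverse_eq_divide divide_le_eq mult.commute)
      qed simp
      have "cmod (Determinant.det (submatrix ?M ({0..m} - L - {0}) ({0..m} - K)) *
          vandermonde_product w e L / Determinant.det ?M) =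
        cmod (Determinant.det (submatrix ?M ({0..m} - L - {0}) ({0..m} - K))) *
        cmod (vandermonde_product w e L) * cmod (inverse (Determinant.det ?M))"
        by (simp only: divide_inverse norm_mult)
      also have "\<dots> \<le> (fact n * (cmod z ^ N1) ^ n) * (2 * cmod z ^ N2) ^ (m + 1)\<^sup>2 * cmod z ^ N3"
        by (intro mult_mono d v q) auto
      also have "\<dots> = C * cmod z ^ p"
        by (simp only: C_def p_def power_mult_distrib power_mult power_add mult_ac)
      finally show "cmod (Determinant.det (submatrix ?M ({0..m} - L - {0}) ({0..m} - K)) *
          vandermonde_product w e L / Determinant.det ?M) \<le> C * cmod z ^ p" .
    qed
  qed
  then show ?thesis by blast
qed

end

section \<open>Hermite--Pade polynomials\<close>

lemma bounded_if_holomorphic_at_infinity: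
  assumes "holomorphic_at_infinity g"
  shows "g \<in> O[at_infinity](\<lambda>_. 1)"
proof -
  obtain h where h: "h analytic_on {0}" "\<forall>\<^sub>F z in at_infinity. g z = h (inverse z)"
    using assms by (auto simp: holomorphic_at_infinity_def)
  have "((\<lambda>z. h (inverse z)) \<longlongrightarrow> h 0) at_infinity"
    using analytic_at_imp_isCont[OF h(1)] tendsto_inverse_0
    by (rule isCont_tendsto_compose)
  then have "(\<lambda>z. h (inverse z)) \<in> O[at_infinity](\<lambda>_. 1)"
    by (intro bigoI_tendsto[where c = "h 0"]) auto
  then show ?thesis using landau_o.big.in_cong[OF h(2)] by blast
qed

text \<open>Sets containing \<open>0\<close> are covered by the definition of the polynomials; for
  the others the Koszul identity gives a combination whose coefficients, germs holomorphic at
  infinity, are bounded.\<close>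

lemma koszul_hermite_pade_bigo:
  assumes hp: "hermite_pade m k n g P"
    and g: "\<And>j. j \<in> {1..m} \<Longrightarrow> holomorphic_at_infinity (g j)"
    and K: "K \<in> multi_indices m (Suc k)"
  shows "(\<lambda>z. koszul (\<lambda>I. poly (P I) z) (\<lambda>j. if j = 0 then 1 else g j z) K)
    \<in> O[at_infinity](\<lambda>z. 1 / z ^ (k * n + 1))"
proof -
  let ?T = "\<lambda>K z. koszul (\<lambda>I. poly (P I) z) (\<lambda>j. if j = 0 then 1 else g j z) K"
  have *: "?T (insert 0 J) \<in> O[at_infinity](\<lambda>z. 1 / z ^ (k * n + 1))"
    if J: "J \<in> multi_indices m k" "0 \<notin> J" for J
  proof -
    have "(\<lambda>z. poly (P J) z + (\<Sum>s=1..k. (-1) ^ s *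
        poly (P (insert 0 (J - {sorted_list_of_set J ! (s - 1)}))) z * g (sorted_list_of_set J ! (s - 1)) z))
         \<in> O[at_infinity](\<lambda>z. 1 / z ^ (k * n + 1))"
      using hp J unfolding hermite_pade_def Let_def by blast
    also have "(\<lambda>z. poly (P J) z + (\<Sum>s=1..k. (-1) ^ s *
        poly (P (insert 0 (J - {sorted_list_of_set J ! (s - 1)}))) z * g (sorted_list_of_set J ! (s - 1)) z)) = ?T (insert 0 J)"
    proof
      fix z
      have len: "length (sorted_list_of_set J) = k" and fin: "finite J"
        using J by (auto simp: multi_indices_def finite_subset[of _ "{0..m}"])
      \<comment> \<open>As \<open>0\<close> is not in \<open>J\<close>, the family extended by
        \<open>1\<close> at index \<open>0\<close> agrees with \<open>g\<close> at every entry that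
        occurs.\<close>
      have ne: "sorted_list_of_set J ! (s - 1) \<noteq> 0" if "s \<in> {1..k}" for s
      proof -
        have "s - 1 < length (sorted_list_of_set J)" using that len by auto
        from nth_mem[OF this] show ?thesis using fin J(2) by (metis set_sorted_list_of_set)
      qed
      have "(\<Sum>s=1..k. (-1) ^ s *
        poly (P (insert 0 (J - {sorted_list_of_set J ! (s - 1)}))) z * g (sorted_list_of_set J ! (s - 1)) z) =
        (\<Sum>s=1..k. (-1) ^ s * poly (P (insert 0 (J - {sorted_list_of_set J ! (s - 1)}))) z *
          (if sorted_list_of_set J ! (s - 1) = 0 then 1 else g (sorted_list_of_set J ! (s - 1)) z))"
        by (intro sum.cong refl) (simp only: ne if_False)
      then show "poly (P J) z + (\<Sum>s=1..k. (-1) ^ s *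
        poly (P (insert 0 (J - {sorted_list_of_set J ! (s - 1)}))) z * g (sorted_list_of_set J ! (s - 1)) z) = ?T (insert 0 J) z"
        using hermite_pade_sum_eq_koszul[OF J, of "\<lambda>j. if j = 0 then 1 else g j z" "\<lambda>I. poly (P I) z"] by simp
    qed
    finally show ?thesis .
  qed
  have fin: "finite K" using K by (auto simp: multi_indices_def finite_subset[of _ "{0..m}"])
  show ?thesis
  proof (cases "0 \<in> K")
    case True
    then have "K - {0} \<in> multi_indices m k" using K fin by (auto simp: multi_indices_def card_Diff_singleton)
    from *[OF this] True show ?thesis by (simp add: insert_absorb)
  next
    case False
    have "(\<lambda>z. \<Sum>j\<in>K. (-1) ^ rank_in K j * (if j = 0 then 1 else g j z) * ?T (insert 0 (K - {j})) z)
      \<in> O[at_infinity](\<lambda>z. 1 / z ^ (k * n + 1))"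
    proof (rule big_sum_in_bigo)
      fix j assume j: "j \<in> K"
      then have j': "j \<in> {1..m}" "j \<noteq> 0" using K False by (auto simp: multi_indices_def Suc_le_eq intro: Nat.gr0I)
      have "K - {j} \<in> multi_indices m k" "0 \<notin> K - {j}"
        using K fin j False by (auto simp: multi_indices_def card_Diff_singleton)
      note T = *[OF this]
      have "(\<lambda>z. (-1) ^ rank_in K j * g j z) \<in> O[at_infinity](\<lambda>_. 1)"
        using bounded_if_holomorphic_at_infinity[OF g[OF j'(1)]]
        by (subst landau_o.big.cmult_in_iff) auto
      from landau_o.big.mult[OF this T] show
        "(\<lambda>z. (-1) ^ rank_in K j * (if j = 0 then 1 else g j z) * ?T (insert 0 (K - {j})) z)
          \<in> O[at_infinity](\<lambda>z. 1 / z ^ (k * n + 1))"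
        using j' by simp
    qed
    moreover have "?T K = (\<lambda>z. \<Sum>j\<in>K. (-1) ^ rank_in K j * (if j = 0 then 1 else g j z) * ?T (insert 0 (K - {j})) z)"
      by (intro ext koszul_eq_sum_koszul_insert_0[OF fin False]) simp
    ultimately show ?thesis by (simp only:)
  qed
qed

text \<open>\<open>A_function\<close> recovers the labels from the set of points, which returns
  exactly \<open>L\<close> because distinct sheets are distinct points.\<close>

lemma A_function_collection_point:
  assumes "bij_betw (sheet X \<A> \<pi> u z) {0..m} S" "L \<subseteq> {0..m}"
  shows "A_function X \<A> m \<pi> u f w I (collection_point X \<A> \<pi> u z L) =
    algebraic_complement (system_matrix m f (sheet X \<A> \<pi> u z)) L I *
      vandermonde_product w (sheet X \<A> \<pi> u z) L / Determinant.det (system_matrix m f (sheet X \<A> \<pi> u z))"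
proof -
  have "{l \<in> {0..m}. sheet X \<A> \<pi> u z l \<in> sheet X \<A> \<pi> u z ` L} = L"
    using assms by (auto simp: bij_betw_def dest: inj_onD)
  then show ?thesis by (simp add: A_function_def collection_point_def Let_def)
qed

theorem theorem3:
  fixes X :: "'a topology" and \<A> :: "'a chart set"
    and m k :: nat
    and \<pi> w :: "'a \<Rightarrow> complex option"
    and f :: "nat \<Rightarrow> 'a \<Rightarrow> complex option"
    and p\<^sub>0 :: 'a and s :: "complex option \<Rightarrow> 'a" and u :: "'a \<Rightarrow> real"
  assumes "riemann_surface X \<A>" and "compact_space X" and "connected_space X"
    and "m \<ge> 1" and "branched_covering X \<A> (m + 1) \<pi>"
    and "\<And>j. j \<in> {1..m} \<Longrightarrow> meromorphic_function X \<A> (f j)"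
    and "lin_indep_over_rational X \<pi> m f"
    and "p\<^sub>0 \<in> fiber X \<pi> None" and "p\<^sub>0 \<notin> critical_points X \<A> \<pi>"
    and "local_inverse_at_infinity X \<pi> p\<^sub>0 s"
    and "\<And>j. j \<in> {1..m} \<Longrightarrow> holomorphic_at_infinity (germ_at_infinity (f j) s)"
    and "nuttall_function X \<A> m \<pi> p\<^sub>0 u"
    and "meromorphic_function X \<A> w" and "generates_function_field X \<A> \<pi> w"
    and "k \<in> {1..m}"
  shows "\<exists>p::nat. \<forall>n P. hermite_pade m k n (\<lambda>j. germ_at_infinity (f j) s) P \<longrightarrow>
           (\<forall>L\<in>multi_indices m k. 0 \<notin> L \<longrightarrow>
             (\<lambda>z. \<Sum>I\<in>multi_indices m k.
                poly (P I) z *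
                A_function X \<A> m \<pi> u f w I (collection_point X \<A> \<pi> u (Some z) L))
             \<in> O[inf at_infinity
                   (principal {z. Some z \<notin> nuttall_set X \<A> m \<pi> u})](\<lambda>z.
                  1 / z powi (int (n * k) + 1 - int p)))"
proof -
  interpret sphere_covering X \<A> m \<pi>
    using assms(1,2,3,5) by unfold_locales
  have f: "holomorphic_map X \<A> riemann_sphere riemann_sphere_atlas (f j)" if "j \<in> {1..m}" for j
    using assms(6)[OF that] by (simp add: meromorphic_function_def)
  have w: "holomorphic_map X \<A> riemann_sphere riemann_sphere_atlas w"
    using assms(13) by (simp add: meromorphic_function_def)
  \<comment> \<open>Both constants are fixed before \<open>n\<close>, \<open>P\<close> and
    \<open>L\<close>, so \<open>p\<close> does not depend on them.\<close>
  obtain C and p :: nat where Cp: "\<forall>\<^sub>F z in at_infinity. \<forall>e L K. bij_betw e {0..m} (fiber X \<pi> (Some z)) \<longrightarrow>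
    L \<in> multi_indices m k \<longrightarrow> 0 \<notin> L \<longrightarrow> K \<in> multi_indices m (Suc k) \<longrightarrow>
    cmod (Determinant.det (submatrix (system_matrix m f e) ({0..m} - L - {0}) ({0..m} - K)) *
      vandermonde_product w e L / Determinant.det (system_matrix m f e)) \<le> C * cmod z ^ p"
    using coefficient_bound[of f w k] f w by blast
  let ?F = "inf at_infinity (principal {z. Some z \<notin> nuttall_set X \<A> m \<pi> u})"
  let ?e = "\<lambda>z. sheet X \<A> \<pi> u (Some z)"
  let ?M = "\<lambda>z. system_matrix m f (?e z)"
  have F: "eventually P ?F" if "eventually P at_infinity" for P
    using that by (simp add: eventually_inf_principal eventually_mono)
  \<comment> \<open>The distinguished branch carries the strict minimum of \<open>u\<close> and is
    therefore sheet \<open>0\<close>.\<close>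
  have sheets: "\<forall>\<^sub>F z in ?F. bij_betw (?e z) {0..m} (fiber X \<pi> (Some z)) \<and> ?e z 0 = s (Some z)"
    unfolding eventually_inf_principal
    using unramified_at_infinity local_inverse_at_infinityE(1)[OF assms(10)]
      nuttall_function_min[OF assms(8,9,10,12)]
  proof eventually_elim
    case (elim z)
    show ?case
    proof
      assume "z \<in> {z. Some z \<notin> nuttall_set X \<A> m \<pi> u}"
      then have z: "Some z \<notin> nuttall_set X \<A> m \<pi> u" by simp
      note sb = sheet_bij_betw[OF conjunct1[OF elim(1)] conjunct2[OF elim(1)] z]
      show "bij_betw (?e z) {0..m} (fiber X \<pi> (Some z)) \<and> ?e z 0 = s (Some z)"
        using sb(1) sb(2)[OF elim(2,3)] by blast
    qed
  qed
  show ?thesis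
  proof (intro exI[of _ p] allI impI ballI)
    fix n P L
    assume hp: "hermite_pade m k n (\<lambda>j. germ_at_infinity (f j) s) P"
      and L: "L \<in> multi_indices m k" "0 \<notin> L"
    define T where "T K z = koszul (\<lambda>I. poly (P I) z) (\<lambda>j. if j = 0 then 1 else germ_at_infinity (f j) s z) K" for K z
    \<comment> \<open>The Vandermonde product and the determinant do not depend on the columns, so
      they move from the sum over \<open>I\<close> to the sum over \<open>K\<close> as a common
      factor.\<close>
    define c where "c K z = (-1) ^ (\<Sum>K + \<Sum>L) *
      (Determinant.det (submatrix (?M z) ({0..m} - L - {0}) ({0..m} - K)) *
        vandermonde_product w (?e z) L / Determinant.det (?M z))" for K z
    have "(\<lambda>z. \<Sum>K\<in>multi_indices m (Suc k). c K z * T K z) \<in> O[?F](\<lambda>z. z ^ p * (1 / z ^ (k * n + 1)))"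
    proof (intro big_sum_in_bigo landau_o.big.mult)
      fix K assume K: "K \<in> multi_indices m (Suc k)"
      show "T K \<in> O[?F](\<lambda>z. 1 / z ^ (k * n + 1))"
        unfolding T_def using koszul_hermite_pade_bigo[OF hp assms(11) K]
        by (rule landau_o.big.filter_mono[rotated]) simp_all
      show "c K \<in> O[?F](\<lambda>z. z ^ p)"
      proof (rule bigoI[of _ C])
        show "\<forall>\<^sub>F z in ?F. cmod (c K z) \<le> C * cmod (z ^ p)"
          using sheets F[OF Cp]
        proof eventually_elim
          case (elim z)
          have "cmod (c K z) = cmod (Determinant.det (submatrix (?M z) ({0..m} - L - {0}) ({0..m} - K)) *
            vandermonde_product w (?e z) L / Determinant.det (?M z))"
            unfolding c_def by (simp only: norm_mult norm_power norm_minus_cancel norm_one power_one mult_1)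
          also have "\<dots> \<le> C * cmod z ^ p" using elim(2)[rule_format, OF conjunct1[OF elim(1)] L K] .
          finally show ?case by (simp add: norm_power)
        qed
      qed
    qed
    also have "?this \<longleftrightarrow> (\<lambda>z. \<Sum>I\<in>multi_indices m k. poly (P I) z *
        A_function X \<A> m \<pi> u f w I (collection_point X \<A> \<pi> u (Some z) L))
        \<in> O[?F](\<lambda>z. z ^ p * (1 / z ^ (k * n + 1)))"
    proof (rule landau_o.big.in_cong)
      show "\<forall>\<^sub>F z in ?F. (\<Sum>K\<in>multi_indices m (Suc k). c K z * T K z) =
        (\<Sum>I\<in>multi_indices m k. poly (P I) z *
          A_function X \<A> m \<pi> u f w I (collection_point X \<A> \<pi> u (Some z) L))"
        using sheets
      proof eventually_elim
        case (elim z)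
        then have bij: "bij_betw (?e z) {0..m} (fiber X \<pi> (Some z))" and e0: "?e z 0 = s (Some z)" by auto
        have L': "L \<subseteq> {0..m}" using L by (auto simp: multi_indices_def)
        \<comment> \<open>Row \<open>0\<close> of the matrix is evaluated at
          \<open>s (Some z)\<close> and hence consists of \<open>1\<close> and the germs.\<close>
        have "koszul (\<lambda>I. poly (P I) z) (\<lambda>j. ?M z $$ (0, j)) K = T K z"
          if K: "K \<in> multi_indices m (Suc k)" for K
          unfolding koszul_def T_def
        proof (rule sum.cong[OF refl])
          fix j assume "j \<in> K"
          then have "j \<le> m" using K by (auto simp: multi_indices_def)
          then show "(-1) ^ rank_in K j * poly (P (K - {j})) z * ?M z $$ (0, j) =
            (-1) ^ rank_in K j * poly (P (K - {j})) z * (if j = 0 then 1 else germ_at_infinity (f j) s z)"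
            by (simp add: col_def e0 germ_at_infinity_def)
        qed
        then have "(\<Sum>K\<in>multi_indices m (Suc k). c K z * T K z) =
          (\<Sum>K\<in>multi_indices m (Suc k). (-1) ^ (\<Sum>K + \<Sum>L) *
             Determinant.det (submatrix (?M z) ({0..m} - L - {0}) ({0..m} - K)) *
             koszul (\<lambda>I. poly (P I) z) (\<lambda>j. ?M z $$ (0, j)) K) *
          (vandermonde_product w (?e z) L / Determinant.det (?M z))"
          unfolding sum_distrib_right by (intro sum.cong) (simp_all add: c_def)
        also have "\<dots> = (\<Sum>I\<in>multi_indices m k. poly (P I) z * algebraic_complement (?M z) L I) *
          (vandermonde_product w (?e z) L / Determinant.det (?M z))"
          by (simp only: sum_algebraic_complement[OF system_matrix_carrier L])
        also have "\<dots> = (\<Sum>I\<in>multi_indices m k. poly (P I) z *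
          A_function X \<A> m \<pi> u f w I (collection_point X \<A> \<pi> u (Some z) L))"
          unfolding sum_distrib_right A_function_collection_point[OF bij L']
          by (simp only: times_divide_eq_right mult.assoc)
        finally show ?case .
      qed
    qed
    \<comment> \<open>Away from \<open>z = 0\<close> the two comparison functions coincide;
      \<open>powi\<close> is used because the exponent can be negative.\<close>
    also have "O[?F](\<lambda>z. z ^ p * (1 / z ^ (k * n + 1))) = O[?F](\<lambda>z. 1 / z powi (int (n * k) + 1 - int p))"
    proof (rule landau_o.big.cong)
      have "\<forall>\<^sub>F z :: complex in at_infinity. z \<noteq> 0"
        unfolding eventually_at_infinity by (rule exI[of _ 1]) auto
      then show "\<forall>\<^sub>F z in ?F. z ^ p * (1 / z ^ (k * n + 1)) = 1 / z powi (int (n * k) + 1 - int p)"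
      proof (rule eventually_mono[OF F])
        fix z :: complex assume z: "z \<noteq> 0"
        have "int (n * k) + 1 - int p = int (k * n + 1) - int p" by simp
        then have "z powi (int (n * k) + 1 - int p) = z powi int (k * n + 1) / z powi int p"
          using power_int_diff[of z "int (k * n + 1)" "int p"] z by (simp only: simp_thms)
        then show "z ^ p * (1 / z ^ (k * n + 1)) = 1 / z powi (int (n * k) + 1 - int p)"
          by (simp only: power_int_of_nat divide_divide_eq_right times_divide_eq_right mult_1 mult_1_right)
      qed
    qed
    finally show "(\<lambda>z. \<Sum>I\<in>multi_indices m k. poly (P I) z *
        A_function X \<A> m \<pi> u f w I (collection_point X \<A> \<pi> u (Some z) L))
        \<in> O[?F](\<lambda>z. 1 / z powi (int (n * k) + 1 - int p))" .
  qed
qed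

end
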